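(* Let $q$ be an odd prime number and let $n\ge1$ be an integer. The number $N_q(n)$ of index $n$ subgroups in the Hecke group $\mathfrak{H}(q)$ isomorphic to a free product of cyclic groups of order $q$ is odd if and only if $n=2+4(q-1)\eta$, where $\eta$ is a non-negative integer satisfying $$\mathfrak{s}_2((q-1)\eta+1)=\mathfrak{s}_2(\eta)+\mathfrak{s}_2((q-2)\eta+1).$$
   Context: For an odd prime $q$, $\mathfrak{H}(q)=\langle x,y\mid x^2=y^q=1\rangle\cong C_2*C_q$. For a non-negative integer $x$, $\mathfrak{s}_2(x)$ denotes the sum of the digits in the binary expansion of $x$ (with $\mathfrak{s}_2(0)=0$). *)

theory Defs
  imports "HOL-Algebra.Algebra" "HOL-Computational_Algebra.Primes"
begin

section \<open>Monoids of words modulo relations\<close>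

definition word_step :: "'a set \<Rightarrow> ('a list \<times> 'a list) set \<Rightarrow> ('a list \<times> 'a list) set" where
  "word_step A R = {(u @ l @ v, u @ r @ v) | u l r v. u \<in> lists A \<and> v \<in> lists A \<and> (l, r) \<in> R}"

text \<open>The congruence on the free monoid \<open>lists A\<close> generated by \<open>R\<close>.\<close>

definition word_cong :: "'a set \<Rightarrow> ('a list \<times> 'a list) set \<Rightarrow> ('a list \<times> 'a list) set" where
  "word_cong A R = (word_step A R \<union> (word_step A R)\<inverse>)\<^sup>* \<inter> (lists A \<times> lists A)"

definition word_quotient :: "'a set \<Rightarrow> ('a list \<times> 'a list) set \<Rightarrow> 'a list set monoid" where
  "word_quotient A R =
     \<lparr>carrier = lists A // word_cong A R,
      monoid.mult = (\<lambda>U V. \<Union>u\<in>U. \<Union>v\<in>V. word_cong A R `` {u @ v}),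
      one = word_cong A R `` {[]}\<rparr>"

section \<open>Groups given by generators and relators\<close>

text \<open>The letter \<open>(s, True)\<close> stands for the generator \<open>s\<close>, the letter \<open>(s, False)\<close> for its inverse.\<close>

definition presented_group :: "'a set \<Rightarrow> ('a \<times> bool) list set \<Rightarrow> ('a \<times> bool) list set monoid" where
  "presented_group S R =
     word_quotient (S \<times> UNIV)
       ({([(s, b), (s, \<not> b)], []) | s b. s \<in> S} \<union> {(r, []) | r. r \<in> R})"

section \<open>Free products\<close>

definition free_product :: "'i set \<Rightarrow> ('i \<Rightarrow> ('g, 'm) monoid_scheme) \<Rightarrow> ('i \<times> 'g) list set monoid" where
  "free_product I G =
     word_quotient (SIGMA i:I. carrier (G i))
       ({([(i, g), (i, h)], [(i, g \<otimes>\<^bsub>G i\<^esub> h)]) | i g h.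
            i \<in> I \<and> g \<in> carrier (G i) \<and> h \<in> carrier (G i)}
        \<union> {([(i, \<one>\<^bsub>G i\<^esub>)], []) | i. i \<in> I})"

section \<open>Hecke groups\<close>

datatype hecke_gen = Gen_x | Gen_y

definition hecke_group :: "nat \<Rightarrow> (hecke_gen \<times> bool) list set monoid" where
  "hecke_group q = presented_group UNIV {replicate 2 (Gen_x, True), replicate q (Gen_y, True)}"

text \<open>Any number of free factors is allowed. Taking the index sets from \<^typ>\<open>nat\<close>
  is no restriction for subgroups of a Hecke group: such a subgroup is countable, so it can only
  be a free product of countably many nontrivial groups.\<close>

definition is_free_product_of_cyclic :: "nat \<Rightarrow> ('a, 'm) monoid_scheme \<Rightarrow> bool" where
  "is_free_product_of_cyclic q G \<longleftrightarrow>
     (\<exists>I :: nat set. G \<cong> free_product I (\<lambda>_. integer_mod_group q))"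

text \<open>The counted set is finite for \<open>n \<ge> 1\<close>, as a Hecke group is finitely generated; so
  \<^const>\<open>card\<close> is the true number of these subgroups. For \<open>n \<ge> 1\<close>, the condition
  \<open>card (rcosets H) = n\<close> includes that the index is finite.\<close>

definition num_cyclic_free_product_subgroups :: "nat \<Rightarrow> nat \<Rightarrow> nat" where
  "num_cyclic_free_product_subgroups q n =
     card {H. subgroup H (hecke_group q)
            \<and> card (rcosets\<^bsub>hecke_group q\<^esub> H) = n
            \<and> is_free_product_of_cyclic q ((hecke_group q)\<lparr>carrier := H\<rparr>)}"

section \<open>Binary digit sum\<close>

fun bin_digit_sum :: "nat \<Rightarrow> nat" where
  "bin_digit_sum x = (if x = 0 then 0 else x mod 2 + bin_digit_sum (x div 2))"

declare bin_digit_sum.simps [simp del]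

section \<open>The constructions yield groups\<close>

lemma equiv_word_cong: "equiv (lists A) (word_cong A R)"
proof (rule equivI)
  show "word_cong A R \<subseteq> lists A \<times> lists A"
    by (auto simp: word_cong_def)
  show "refl_on (lists A) (word_cong A R)"
    by (auto simp: refl_on_def word_cong_def)
  have "sym ((word_step A R \<union> (word_step A R)\<inverse>)\<^sup>*)"
    by (rule sym_rtrancl) (rule sym_Un_converse)
  then show "sym (word_cong A R)"
    by (auto simp: word_cong_def sym_def)
  show "trans (word_cong A R)"
    by (auto simp: word_cong_def trans_def intro: rtrancl_trans)
qed

lemma word_step_append:
  assumes "(u, v) \<in> word_step A R" "w \<in> lists A" "z \<in> lists A"
  shows "(w @ u @ z, w @ v @ z) \<in> word_step A R"
proof -
  obtain a l r b where *: "u = a @ l @ b" "v = a @ r @ b" "a \<in> lists A" "b \<in> lists A" "(l, r) \<in> R"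
    using assms(1) by (auto simp: word_step_def)
  have "w @ u @ z = (w @ a) @ l @ (b @ z)" "w @ v @ z = (w @ a) @ r @ (b @ z)"
    "w @ a \<in> lists A" "b @ z \<in> lists A"
    using * assms by auto
  then show ?thesis
    using *(5) unfolding word_step_def by blast
qed

lemma word_cong_append:
  assumes "(u, v) \<in> word_cong A R" "w \<in> lists A" "z \<in> lists A"
  shows "(w @ u @ z, w @ v @ z) \<in> word_cong A R"
proof -
  have "(u, v) \<in> (word_step A R \<union> (word_step A R)\<inverse>)\<^sup>*"
    using assms by (simp add: word_cong_def)
  then have "(w @ u @ z, w @ v @ z) \<in> (word_step A R \<union> (word_step A R)\<inverse>)\<^sup>*"
  proof induction
    case (step y y')
    then have "(w @ y @ z, w @ y' @ z) \<in> word_step A R \<union> (word_step A R)\<inverse>"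
      using assms by (auto intro: word_step_append)
    with step.IH show ?case
      by (rule rtrancl_into_rtrancl)
  qed simp
  then show ?thesis
    using assms by (auto simp: word_cong_def)
qed

lemma word_cong_append2:
  assumes "(u, u') \<in> word_cong A R" "(v, v') \<in> word_cong A R"
  shows "(u @ v, u' @ v') \<in> word_cong A R"
proof -
  have *: "u' \<in> lists A" "v \<in> lists A"
    using assms by (auto simp: word_cong_def)
  then have "(u @ v, u' @ v) \<in> word_cong A R" "(u' @ v, u' @ v') \<in> word_cong A R"
    using word_cong_append[OF assms(1), of "[]" v] word_cong_append[OF assms(2), of u' "[]"] by auto
  then show ?thesis
    using equiv_word_cong[of A R] by (meson equivE transE)
qed

lemma word_cong_relation:
  assumes "(l, r) \<in> R" "l \<in> lists A" "r \<in> lists A"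
  shows "(l, r) \<in> word_cong A R"
proof -
  have "(l, r) \<in> word_step A R"
    using assms(1) unfolding word_step_def
    by (intro CollectI exI[of _ "[]"] exI[of _ l] exI[of _ r]) auto
  then show ?thesis
    using assms by (auto simp: word_cong_def)
qed

lemma carrier_word_quotient: "carrier (word_quotient A R) = lists A // word_cong A R"
  by (simp add: word_quotient_def)

lemma one_word_quotient: "\<one>\<^bsub>word_quotient A R\<^esub> = word_cong A R `` {[]}"
  by (simp add: word_quotient_def)

lemma mult_word_quotient:
  assumes "u \<in> lists A" "v \<in> lists A"
  shows "(word_cong A R `` {u}) \<otimes>\<^bsub>word_quotient A R\<^esub> (word_cong A R `` {v})
           = word_cong A R `` {u @ v}"
proof -
  have eq: "word_cong A R `` {u' @ v'} = word_cong A R `` {u @ v}"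
    if "(u, u') \<in> word_cong A R" "(v, v') \<in> word_cong A R" for u' v'
    using equiv_class_eq[OF equiv_word_cong word_cong_append2[OF that]] by simp
  moreover have "(u, u) \<in> word_cong A R" "(v, v) \<in> word_cong A R"
    using assms by (auto simp: word_cong_def)
  ultimately have "(\<Union>a \<in> word_cong A R `` {u}. \<Union>b \<in> word_cong A R `` {v}. word_cong A R `` {a @ b})
      = word_cong A R `` {u @ v}"
    by blast
  then show ?thesis
    by (simp add: word_quotient_def)
qed

lemma group_word_quotient:
  assumes inv: "\<And>a. a \<in> A \<Longrightarrow> \<exists>b \<in> lists A. (b @ [a], []) \<in> word_cong A R"
  shows "group (word_quotient A R)"
proof (rule groupI)
  note simps = carrier_word_quotient one_word_quotient mult_word_quotient[unfolded in_lists_conv_set]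
  show "x \<otimes>\<^bsub>word_quotient A R\<^esub> y \<in> carrier (word_quotient A R)"
    if "x \<in> carrier (word_quotient A R)" "y \<in> carrier (word_quotient A R)" for x y
    using that by (auto simp: simps elim!: quotientE intro!: quotientI)
  show "\<one>\<^bsub>word_quotient A R\<^esub> \<in> carrier (word_quotient A R)"
    by (auto simp: simps intro!: quotientI)
  show "(x \<otimes>\<^bsub>word_quotient A R\<^esub> y) \<otimes>\<^bsub>word_quotient A R\<^esub> z
      = x \<otimes>\<^bsub>word_quotient A R\<^esub> (y \<otimes>\<^bsub>word_quotient A R\<^esub> z)"
    if "x \<in> carrier (word_quotient A R)" "y \<in> carrier (word_quotient A R)"
      "z \<in> carrier (word_quotient A R)" for x y z
    using that unfolding carrier_word_quotient
    by (elim quotientE) (simp add: mult_word_quotient)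
  show "\<one>\<^bsub>word_quotient A R\<^esub> \<otimes>\<^bsub>word_quotient A R\<^esub> x = x"
    if "x \<in> carrier (word_quotient A R)" for x
    using that by (auto simp: simps elim!: quotientE)
  have ex: "\<exists>v \<in> lists A. (v @ u, []) \<in> word_cong A R" if "u \<in> lists A" for u
    using that
  proof induction
    case Nil
    have "([], []) \<in> word_cong A R" by (simp add: word_cong_def)
    then show ?case by (intro bexI[of _ "[]"]) auto
  next
    case (Cons a u)
    then obtain v b where *: "v \<in> lists A" "(v @ u, []) \<in> word_cong A R"
      "b \<in> lists A" "(b @ [a], []) \<in> word_cong A R"
      using inv by blast
    have "(v @ b @ a # u, v @ u) \<in> word_cong A R"
      using word_cong_append[OF *(4) *(1) Cons.hyps(2)] by simp
    then have "((v @ b) @ a # u, []) \<in> word_cong A R"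
      using *(2) equiv_word_cong[of A R] by simp (meson equivE transE)
    then show ?case
      using *(1,3) by (intro bexI[of _ "v @ b"]) auto
  qed
  show "\<exists>y\<in>carrier (word_quotient A R). y \<otimes>\<^bsub>word_quotient A R\<^esub> x = \<one>\<^bsub>word_quotient A R\<^esub>"
    if x: "x \<in> carrier (word_quotient A R)" for x
  proof -
    obtain u where u: "u \<in> lists A" "x = word_cong A R `` {u}"
      using x by (auto simp: simps elim!: quotientE)
    obtain v where v: "v \<in> lists A" "(v @ u, []) \<in> word_cong A R"
      using ex[OF u(1)] by blast
    show ?thesis
    proof (rule bexI)
      show "word_cong A R `` {v} \<otimes>\<^bsub>word_quotient A R\<^esub> x = \<one>\<^bsub>word_quotient A R\<^esub>"
        using equiv_class_eq[OF equiv_word_cong v(2)] u v(1) by (simp add: mult_word_quotient one_word_quotient)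
      show "word_cong A R `` {v} \<in> carrier (word_quotient A R)"
        using v(1) by (auto simp: simps intro!: quotientI)
    qed
  qed
qed

lemma group_presented_group: "group (presented_group S R)"
  unfolding presented_group_def
proof (rule group_word_quotient)
  fix a :: "'a \<times> bool"
  assume "a \<in> S \<times> UNIV"
  then show "\<exists>b \<in> lists (S \<times> UNIV). (b @ [a], []) \<in> word_cong (S \<times> UNIV)
      ({([(s, b), (s, \<not> b)], []) | s b. s \<in> S} \<union> {(r, []) | r. r \<in> R})"
    by (intro bexI[of _ "[(fst a, \<not> snd a)]"] word_cong_relation) (cases a; auto)+
qed

lemma group_free_product:
  assumes G: "\<And>i. i \<in> I \<Longrightarrow> group (G i)"
  shows "group (free_product I G)"
  unfolding free_product_def
proof (rule group_word_quotient)
  fix a :: "'a \<times> 'b"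
  let ?A = "SIGMA i:I. carrier (G i)"
  let ?R = "{([(i, g), (i, h)], [(i, g \<otimes>\<^bsub>G i\<^esub> h)]) | i g h.
        i \<in> I \<and> g \<in> carrier (G i) \<and> h \<in> carrier (G i)} \<union> {([(i, \<one>\<^bsub>G i\<^esub>)], []) | i. i \<in> I}"
  assume "a \<in> ?A"
  then obtain i g where a: "a = (i, g)" "i \<in> I" "g \<in> carrier (G i)"
    by auto
  interpret group "G i"
    using G a by blast
  have "([(i, inv\<^bsub>G i\<^esub> g), (i, g)], [(i, \<one>\<^bsub>G i\<^esub>)]) \<in> ?R"
    using a by (intro UnI1 CollectI exI[of _ i] exI[of _ "inv\<^bsub>G i\<^esub> g"] exI[of _ g]) auto
  then have "([(i, inv\<^bsub>G i\<^esub> g), (i, g)], [(i, \<one>\<^bsub>G i\<^esub>)]) \<in> word_cong ?A ?R"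
    using a by (intro word_cong_relation) auto
  moreover have "([(i, \<one>\<^bsub>G i\<^esub>)], []) \<in> word_cong ?A ?R"
    using a by (intro word_cong_relation) auto
  ultimately have "([(i, inv\<^bsub>G i\<^esub> g), (i, g)], []) \<in> word_cong ?A ?R"
    using equiv_word_cong[of ?A ?R] by (meson equivE transE)
  then show "\<exists>b \<in> lists ?A. (b @ [a], []) \<in> word_cong ?A ?R"
    using a by (intro bexI[of _ "[(i, inv\<^bsub>G i\<^esub> g)]"]) auto
qed

lemma group_hecke_group: "group (hecke_group q)"
  unfolding hecke_group_def by (rule group_presented_group)

end

theory Submission
  imports Defs "HOL-Library.Sublist" "HOL-Library.Countable"
begin

text \<open>The proof is a bijection between the subgroups in question and plane trees, followed by a count of
these trees.

Let the Hecke group act on the right cosets of a subgroup \<open>H\<close>, and regard this as a graph: its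
vertices are the orbits of \<open>y\<close>, which have \<open>1\<close> or \<open>q\<close> elements, its edges are the orbits of
\<open>x\<close>, and an orbit of \<open>x\<close> is incident with the orbits of \<open>y\<close> that it meets. The action of
\<open>y\<close> orders the edges at a vertex cyclically. If \<open>H\<close> is a free product of cyclic groups of order
\<open>q\<close>, then every homomorphism from \<open>H\<close> to the group of order two is trivial, because \<open>q\<close>
is odd (\<open>free_product_of_odd_cyclic_no_parity\<close>). Counting crossings of a given edge modulo two is
such a homomorphism, so closed walks cross every edge an even number of times (\<open>cut_exists\<close>). It
follows that \<open>x\<close> fixes no coset and that every edge is a bridge: the graph is a plane tree with
vertices of degree \<open>1\<close> or \<open>q\<close> and a distinguished directed edge (\<open>dart_rcos_inj\<close>,
\<open>tree_stab_tree_of\<close>).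

Conversely, the Hecke group acts on the directed edges of such a tree, and the stabiliser of a directed
edge is the free product of the cyclic groups of order \<open>q\<close> generated by the loops around the
leaves. To see this without a normal form theorem, the action is enriched by labels in the free
product, which define the inverse of the obvious homomorphism from the free product to the stabiliser
(\<open>walk_label\<close>, \<open>tree_stab_iso\<close>). A tree with \<open>t\<close> vertices of degree \<open>q\<close> has
\<open>2 + 2(q - 1)t\<close> directed edges, and this is the index (\<open>index_tree_stab\<close>,
\<open>card_darts\<close>).

Deleting the distinguished edge leaves an ordered pair of \<open>k\<close>-ary trees with \<open>k = q - 1\<close>, so
the number \<open>N\<close> of trees satisfies \<open>(kt + 2) N = 2 B\<close>, where \<open>B\<close> is the binomial coefficient
of \<open>kt + 2\<close> over \<open>t\<close> (\<open>card_forests\<close>). Its parity follows from Legendre's formula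
(\<open>odd_forest_number\<close>).\<close>

section \<open>Counting forests\<close>

lemma suffix_extend:
  assumes "suffix v u" "u \<noteq> v" obtains i where "suffix (i # v) u"
proof -
  obtain w where w: "u = w @ v" using assms(1) by (auto simp: suffix_def)
  then have "w \<noteq> []" using assms(2) by auto
  then have "u = butlast w @ (last w # v)" using w by simp
  then show thesis using that[of "last w"] by (auto simp: suffix_def)
qed

text \<open>A rooted forest in which every internal vertex has \<open>k\<close> children, encoded by the set of its internal
vertices: \<open>R\<close> is the set of roots, and the children of \<open>u\<close> are \<open>i # u\<close> for \<open>i < k\<close>.
The parameter \<open>t\<close> is the number of internal vertices.\<close>

definition forests :: "nat \<Rightarrow> nat list set \<Rightarrow> nat \<Rightarrow> nat list set set" where
  "forests k R t =
     {M. finite M \<and> card M = t \<and> (\<forall>v\<in>M. v \<in> R \<or> (\<exists>i<k. \<exists>u\<in>M. v = i # u))}"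

lemma forest_below_root:
  assumes "\<forall>v\<in>M. v \<in> R \<or> (\<exists>i<k. \<exists>u\<in>M. v = i # u)" "v \<in> M"
  shows "\<exists>r\<in>R. suffix r v"
  using assms(2)
proof (induction v)
  case Nil
  then show ?case using assms(1) by force
next
  case (Cons a v)
  then show ?case
    using assms(1) by (metis list.inject suffix_ConsI suffix_order.order_refl)
qed

lemma forests_0: "forests k R 0 = {{}}"
  unfolding forests_def by auto

lemma forests_no_root: "t > 0 \<Longrightarrow> forests k {} t = {}"
  unfolding forests_def using forest_below_root[of _ "{}" k] by fastforce

text \<open>Either the root \<open>a\<close> is a leaf, and can be deleted, or it is internal, and can be replaced by its
children. The roots must be incomparable, so that no root is a descendant of another; this is
preserved.\<close>

lemma forests_split:
  assumes anti: "\<And>u v. u \<in> R \<Longrightarrow> v \<in> R \<Longrightarrow> suffix u v \<Longrightarrow> u = v" and a: "a \<in> R"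
    and R'_def: "R' = (R - {a}) \<union> (\<lambda>i. i # a) ` {..<k}"
  shows "forests k R (Suc t) = forests k (R - {a}) (Suc t) \<union> insert a ` forests k R' t"
    and "\<And>M. M \<in> forests k (R - {a}) t' \<Longrightarrow> a \<notin> M"
    and "\<And>M. M \<in> forests k R' t' \<Longrightarrow> a \<notin> M"
    and "\<And>u v. u \<in> R' \<Longrightarrow> v \<in> R' \<Longrightarrow> suffix u v \<Longrightarrow> u = v"
proof -
  show 1: "a \<notin> M" if "M \<in> forests k (R - {a}) t'" for M t'
    using that forest_below_root[of M "R - {a}" k a] anti a unfolding forests_def by blast
  show 2: "a \<notin> M" if "M \<in> forests k R' t'" for M t'
  proof
    assume "a \<in> M"
    then obtain r where r: "r \<in> R'" "suffix r a"
      using forest_below_root[of M R' k a] \<open>M \<in> _\<close> unfolding forests_def by blast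
    then show False
      using anti[of r a] a unfolding R'_def by (auto dest: suffix_length_le)
  qed
  show "u = v" if uv: "u \<in> R'" "v \<in> R'" "suffix u v" for u v
  proof (cases "u \<in> R - {a}")
    case True
    show ?thesis
    proof (cases "v \<in> R - {a}")
      case False
      then obtain i where v: "v = i # a" using uv R'_def by auto
      then have "u = v \<or> suffix u a" using uv(3) by (simp add: suffix_Cons)
      then show ?thesis using True anti[of u a] a by auto
    qed (use True anti uv in auto)
  next
    case False
    then obtain i where u: "u = i # a" using uv R'_def by auto
    show ?thesis
    proof (cases "v \<in> R - {a}")
      case True
      have "suffix a v" using uv(3) u by (metis suffix_ConsD)
      then show ?thesis using anti[of a v] True a by auto
    next
      case False
      then obtain j where "v = j # a" using uv R'_def by auto
      then show ?thesis using uv(3) u by (auto dest: suffix_length_le simp: suffix_Cons)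
    qed
  qed
  show "forests k R (Suc t) = forests k (R - {a}) (Suc t) \<union> insert a ` forests k R' t"
  proof (intro equalityI subsetI)
    fix M assume M: "M \<in> forests k R (Suc t)"
    show "M \<in> forests k (R - {a}) (Suc t) \<union> insert a ` forests k R' t"
    proof (cases "a \<in> M")
      case True
      have "M - {a} \<in> forests k R' t"
        using M True unfolding forests_def R'_def by (fastforce simp: card_Diff_singleton)
      then show ?thesis using True by (metis UnCI image_eqI insert_Diff)
    next
      case False
      then have "M \<in> forests k (R - {a}) (Suc t)"
        using M unfolding forests_def by blast
      then show ?thesis by blast
    qed
  next
    fix M assume "M \<in> forests k (R - {a}) (Suc t) \<union> insert a ` forests k R' t"
    then show "M \<in> forests k R (Suc t)"
    proof
      assume "M \<in> forests k (R - {a}) (Suc t)"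
      then show ?thesis unfolding forests_def by blast
    next
      assume "M \<in> insert a ` forests k R' t"
      then obtain N where N: "M = insert a N" "N \<in> forests k R' t" by blast
      then show ?thesis
        using 2[OF N(2)] a unfolding forests_def R'_def by auto
    qed
  qed
qed

text \<open>The number of forests with \<open>r\<close> roots and \<open>t\<close> internal vertices is \<open>r/(kt + r)\<close> times
the binomial coefficient of \<open>kt + r\<close> over \<open>t\<close>. Both kinds of forests in \<open>forests_split\<close>
have parameter \<open>kt + r - 1\<close>, which gives an induction on \<open>kt + r\<close>.\<close>

lemma card_forests:
  assumes "finite R" "\<And>u v. u \<in> R \<Longrightarrow> v \<in> R \<Longrightarrow> suffix u v \<Longrightarrow> u = v" "k \<ge> 1"
  shows "finite (forests k R t) \<and>
    (k * t + card R) * card (forests k R t) = card R * ((k * t + card R) choose t)"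
  using assms(1,2)
proof (induction "k * t + card R" arbitrary: R t rule: less_induct)
  case less
  show ?case
  proof (cases "t = 0 \<or> R = {}")
    case True
    then show ?thesis by (cases "t = 0") (auto simp: forests_0 forests_no_root)
  next
    case False
    then obtain a s where a: "a \<in> R" and t: "t = Suc s" using not0_implies_Suc by blast
    define R' where "R' = (R - {a}) \<union> (\<lambda>i. i # a) ` {..<k}"
    obtain r where r: "card R = Suc r" using a less.prems(1) by (metis card_Suc_Diff1)
    have r1: "card (R - {a}) = r" using r a less.prems(1) by simp
    have "(R - {a}) \<inter> (\<lambda>i. i # a) ` {..<k} = {}"
      using less.prems(2)[OF a] by (fastforce simp: suffix_ConsI)
    then have r2: "card R' = r + k"
      unfolding R'_def using less.prems(1) r1
      by (subst card_Un_disjoint) (auto simp: card_image inj_on_def)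
    note split = forests_split[OF less.prems(2) a R'_def]
    define L where "L = k * t + r"
    have L1: "k * s + card R' = L" "k * t + card (R - {a}) = L" "k * t + card R = Suc L"
      unfolding L_def t r r1 r2 by auto
    have IH1: "finite (forests k (R - {a}) t) \<and> L * card (forests k (R - {a}) t) = r * (L choose t)"
      using less.hyps[of t "R - {a}"] less.prems L1 r1 by auto
    have IH2: "finite (forests k R' s) \<and> L * card (forests k R' s) = (r + k) * (L choose s)"
    proof -
      have "finite R'" unfolding R'_def using less.prems(1) by auto
      then show ?thesis using less.hyps[of s R'] split(4) L1 r2 by auto
    qed
    have eq: "forests k R t = forests k (R - {a}) t \<union> insert a ` forests k R' s"
      using split(1) t by simp
    have disj: "forests k (R - {a}) t \<inter> insert a ` forests k R' s = {}"
      using split(2) by blast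
    have inj: "inj_on (insert a) (forests k R' s)"
      using split(3) by (intro inj_onI) (metis insert_ident)
    have card: "card (forests k R t) = card (forests k (R - {a}) t) + card (forests k R' s)"
      unfolding eq using IH1 IH2 disj inj by (subst card_Un_disjoint) (auto simp: card_image)
    have b1: "Suc L * (L choose s) = (Suc L choose t) * t"
      unfolding t by (rule Suc_times_binomial_eq)
    have b2: "Suc L * (L choose t) + t * (Suc L choose t) = Suc L * (Suc L choose t)"
    proof -
      have "Suc L * (L choose t) + Suc L * (L choose s) = Suc L * (Suc L choose t)"
        unfolding t by (simp add: algebra_simps)
      then show ?thesis using b1 by (simp add: algebra_simps)
    qed
    have "L * (Suc L * card (forests k R t)) = Suc L * (r * (L choose t) + (r + k) * (L choose s))"
      using IH1 IH2 unfolding card by (simp add: algebra_simps)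
    also have "\<dots> = r * (Suc L * (L choose t)) + (r + k) * (Suc L * (L choose s))"
      by (simp add: algebra_simps)
    also have "\<dots> = r * (Suc L * (L choose t) + t * (Suc L choose t)) + k * t * (Suc L choose t)"
      unfolding b1 by (simp add: algebra_simps)
    also have "\<dots> = L * (Suc r * (Suc L choose t))"
      unfolding b2 by (simp add: L_def algebra_simps)
    finally have "L * (Suc L * card (forests k R t)) = L * (Suc r * (Suc L choose t))" .
    moreover have "L > 0" using assms(3) t L_def by simp
    ultimately show ?thesis
      using IH1 IH2 eq L1 r by simp
  qed
qed

section \<open>Binary digit sums and parity\<close>

lemma bin_digit_sum_double [simp]: "bin_digit_sum (2 * n) = bin_digit_sum n"
  using bin_digit_sum.simps[of "2 * n"] bin_digit_sum.simps[of 0] by (cases "n = 0") auto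

lemma bin_digit_sum_Suc_double [simp]: "bin_digit_sum (Suc (2 * n)) = Suc (bin_digit_sum n)"
  using bin_digit_sum.simps[of "Suc (2 * n)"] by simp

lemma bin_digit_sum_0 [simp]: "bin_digit_sum 0 = 0"
  using bin_digit_sum.simps[of 0] by simp

text \<open>Adding one to \<open>n\<close> turns its trailing ones into zeros and the zero before them into a one, and
the number of trailing ones is the exponent of
two in \<open>n + 1\<close>.\<close>

lemma bin_digit_sum_Suc: "bin_digit_sum (Suc n) + multiplicity 2 (Suc n) = Suc (bin_digit_sum n)"
proof (induction n rule: less_induct)
  case (less n)
  show ?case
  proof (cases "even n")
    case True
    then obtain m where "n = 2 * m" by blast
    then show ?thesis by (simp add: not_dvd_imp_multiplicity_0)
  next
    case False
    then obtain m where n: "n = Suc (2 * m)" by (metis oddE Suc_eq_plus1)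
    then have S: "Suc n = 2 * Suc m" by simp
    have "multiplicity 2 (Suc n) = Suc (multiplicity 2 (Suc m))"
      unfolding S by (subst multiplicity_times_same) auto
    moreover have "bin_digit_sum (Suc n) = bin_digit_sum (Suc m)" "bin_digit_sum n = Suc (bin_digit_sum m)"
      using bin_digit_sum_double[of "Suc m"] by (simp_all add: n)
    ultimately show ?thesis using less.IH[of m] n by simp
  qed
qed

text \<open>Legendre's formula for the prime two.\<close>

lemma multiplicity_fact: "multiplicity 2 (fact n :: nat) + bin_digit_sum n = n"
proof (induction n)
  case (Suc n)
  have "multiplicity 2 (fact (Suc n) :: nat) = multiplicity 2 (Suc n) + multiplicity 2 (fact n :: nat)"
    by (simp add: prime_elem_multiplicity_mult_distrib del: mult_Suc)
  then show ?case using Suc bin_digit_sum_Suc[of n] by linarith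
qed simp

lemma bin_digit_sum_add_le: "bin_digit_sum (a + b) \<le> bin_digit_sum a + bin_digit_sum b"
proof -
  have "multiplicity 2 (fact (a + b) :: nat) =
      multiplicity 2 ((a + b choose a) * (fact a * fact b :: nat))"
    using binomial_fact_lemma[of a "a + b"] by (simp add: algebra_simps)
  also have "\<dots> = multiplicity 2 (a + b choose a) + (multiplicity 2 (fact a :: nat) + multiplicity 2 (fact b :: nat))"
    by (subst prime_elem_multiplicity_mult_distrib; simp)+
  finally show ?thesis
    using multiplicity_fact[of a] multiplicity_fact[of b] multiplicity_fact[of "a + b"] by linarith
qed

text \<open>By Legendre's formula, the exponent of two in \<open>N\<close> is
\<open>s(t) + s((k - 1)t + 2) - s(kt) - 1\<close>, where \<open>s\<close> is the binary digit sum. It is positive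
for odd \<open>t\<close>, as \<open>s\<close> is subadditive, and for \<open>t = 2h\<close> it is the difference of the two
sides of the stated equation.\<close>

lemma odd_forest_number:
  fixes N k t :: nat
  assumes N: "(k * t + 2) * N = 2 * (k * t + 2 choose t)" and "even k" "k > 0"
  shows "odd N \<longleftrightarrow> (\<exists>h. t = 2 * h \<and>
     bin_digit_sum (k * h + 1) = bin_digit_sum h + bin_digit_sum ((k - 1) * h + 1))"
proof -
  obtain j where k: "k = 2 * j" using assms(2) by blast
  define u where "u = k * t + 2 - t"
  have tk: "t \<le> k * t" using assms(3) by simp
  have u: "u + t = k * t + 2" "u = (k - 1) * t + 2"
    using tk unfolding u_def diff_mult_distrib by linarith+
  have N': "Suc (j * t) * N = (k * t + 2) choose t"
    using N k by simp
  have Npos: "N \<noteq> 0"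
    using N' u(1) by (metis le_add2 mult_is_0 zero_less_binomial_iff less_numeral_extra(3))
  have "fact (k * t + 2) = Suc (j * t) * N * (fact t * fact u :: nat)"
    unfolding N' using binomial_fact_lemma[of t "k * t + 2"] u(1) u_def by (simp add: algebra_simps)
  then have "multiplicity 2 (fact (k * t + 2) :: nat) =
     multiplicity 2 (Suc (j * t)) + multiplicity 2 N + (multiplicity 2 (fact t :: nat) + multiplicity 2 (fact u :: nat))"
    using Npos by (simp add: prime_elem_multiplicity_mult_distrib del: mult_Suc)
  moreover have "bin_digit_sum (k * t + 2) = bin_digit_sum (Suc (j * t))"
    using bin_digit_sum_double[of "Suc (j * t)"] k by (simp add: mult.assoc)
  ultimately have v: "multiplicity 2 N + Suc (bin_digit_sum (j * t)) = bin_digit_sum t + bin_digit_sum u"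
    using multiplicity_fact[of "k * t + 2"] multiplicity_fact[of t] multiplicity_fact[of u]
      bin_digit_sum_Suc[of "j * t"] u(1) by linarith
  have oddN: "odd N \<longleftrightarrow> multiplicity 2 N = 0"
    using Npos by (simp add: multiplicity_eq_zero_iff)
  show ?thesis
  proof (cases "even t")
    case True
    then obtain h where t: "t = 2 * h" by blast
    have "u = 2 * ((k - 1) * h + 1)" using u(2) t by simp
    then have "bin_digit_sum u = bin_digit_sum ((k - 1) * h + 1)"
      by (simp only: bin_digit_sum_double)
    then have "multiplicity 2 N + Suc (bin_digit_sum (k * h)) = bin_digit_sum h + bin_digit_sum ((k - 1) * h + 1)"
      using v t k by (simp add: mult.assoc mult.left_commute)
    moreover have "bin_digit_sum (k * h + 1) = Suc (bin_digit_sum (k * h))"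
      using bin_digit_sum_Suc_double[of "j * h"] bin_digit_sum_double[of "j * h"] k by (simp add: mult.assoc)
    ultimately show ?thesis using oddN t by auto
  next
    case False
    then obtain a where t: "t = Suc (2 * a)" by (metis oddE Suc_eq_plus1)
    have "odd u" using u False assms(2) by (metis even_add even_mult_iff even_numeral)
    then obtain b where b: "u = Suc (2 * b)" by (metis oddE Suc_eq_plus1)
    have "a + b = j * t" using u(1) t b k by simp
    then have "bin_digit_sum (j * t) \<le> bin_digit_sum a + bin_digit_sum b"
      using bin_digit_sum_add_le[of a b] by simp
    then have "multiplicity 2 N \<noteq> 0" using v t b by simp
    then show ?thesis using oddN False by auto
  qed
qed

section \<open>Homomorphisms out of word quotients\<close>

text \<open>The product in \<open>K\<close> of the images under \<open>f\<close> of the letters of a word.\<close>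

definition eval_word :: "('k, 'm) monoid_scheme \<Rightarrow> ('a \<Rightarrow> 'k) \<Rightarrow> 'a list \<Rightarrow> 'k" where
  "eval_word K f w = foldr (\<lambda>a b. f a \<otimes>\<^bsub>K\<^esub> b) w \<one>\<^bsub>K\<^esub>"

lemma eval_word_simps [simp]:
  "eval_word K f [] = \<one>\<^bsub>K\<^esub>" "eval_word K f (a # w) = f a \<otimes>\<^bsub>K\<^esub> eval_word K f w"
  by (simp_all add: eval_word_def)

lemma (in monoid) eval_word_closed:
  "f \<in> A \<rightarrow> carrier G \<Longrightarrow> w \<in> lists A \<Longrightarrow> eval_word G f w \<in> carrier G"
  by (induction w) auto

lemma (in monoid) eval_word_append:
  "f \<in> A \<rightarrow> carrier G \<Longrightarrow> u \<in> lists A \<Longrightarrow> v \<in> lists A \<Longrightarrow>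
    eval_word G f (u @ v) = eval_word G f u \<otimes> eval_word G f v"
  by (induction u) (auto simp: m_assoc eval_word_closed[of f A] Pi_iff)

lemma (in monoid) eval_word_replicate:
  "f a \<in> carrier G \<Longrightarrow> eval_word G f (replicate n a) = f a [^] n"
proof (induction n)
  case (Suc n)
  then show ?case using nat_pow_Suc2[of "f a" n] by simp
qed simp

lemma word_class_eq:
  assumes "(l, r) \<in> R" "l \<in> lists A" "r \<in> lists A"
  shows "word_cong A R `` {l} = word_cong A R `` {r}"
  using equiv_class_eq[OF equiv_word_cong word_cong_relation[OF assms]] .

lemma (in monoid) word_quotient_hom:
  assumes f: "f \<in> A \<rightarrow> carrier G" and R: "R \<subseteq> lists A \<times> lists A"
    and rel: "\<And>l r. (l, r) \<in> R \<Longrightarrow> eval_word G f l = eval_word G f r"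
  obtains \<phi> where "\<phi> \<in> hom (word_quotient A R) G"
    and "\<And>w. w \<in> lists A \<Longrightarrow> \<phi> (word_cong A R `` {w}) = eval_word G f w"
proof -
  define \<phi> where "\<phi> U = eval_word G f (SOME u. u \<in> U)" for U
  have step: "eval_word G f u = eval_word G f v" if uv: "(u, v) \<in> word_step A R" for u v
  proof -
    obtain a l r b where *: "u = a @ l @ b" "v = a @ r @ b" "a \<in> lists A" "b \<in> lists A" "(l, r) \<in> R"
      using uv by (auto simp: word_step_def simp del: in_lists_conv_set)
    then have "l \<in> lists A" "r \<in> lists A" using R by auto
    then show ?thesis
      using * rel[OF *(5)] by (simp add: eval_word_append[OF f] del: in_lists_conv_set)
  qed
  have cong: "eval_word G f u = eval_word G f v" if "(u, v) \<in> word_cong A R" for u v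
  proof -
    have "(u, v) \<in> (word_step A R \<union> (word_step A R)\<inverse>)\<^sup>*"
      using that by (simp add: word_cong_def)
    then show ?thesis by induction (use step in auto)
  qed
  have \<phi>: "\<phi> (word_cong A R `` {w}) = eval_word G f w" if "w \<in> lists A" for w
  proof -
    have "w \<in> word_cong A R `` {w}"
      using that equiv_class_self[OF equiv_word_cong] by metis
    then have "(SOME u. u \<in> word_cong A R `` {w}) \<in> word_cong A R `` {w}"
      by (rule someI)
    then show ?thesis unfolding \<phi>_def using cong by simp
  qed
  have "\<phi> \<in> hom (word_quotient A R) G"
  proof (rule homI)
    fix U assume "U \<in> carrier (word_quotient A R)"
    then obtain u where "u \<in> lists A" "U = word_cong A R `` {u}"
      unfolding carrier_word_quotient by (rule quotientE)
    then show "\<phi> U \<in> carrier G" using \<phi> eval_word_closed[OF f] by simp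
  next
    fix U V assume "U \<in> carrier (word_quotient A R)" "V \<in> carrier (word_quotient A R)"
    then obtain u v where "u \<in> lists A" "U = word_cong A R `` {u}" "v \<in> lists A" "V = word_cong A R `` {v}"
      unfolding carrier_word_quotient by (metis quotientE)
    then show "\<phi> (U \<otimes>\<^bsub>word_quotient A R\<^esub> V) = \<phi> U \<otimes> \<phi> V"
      using \<phi>[of "u @ v"] \<phi> eval_word_append[OF f] by (simp add: mult_word_quotient)
  qed
  then show thesis using \<phi> that by blast
qed

section \<open>Free products\<close>

abbreviation fp_letters :: "'i set \<Rightarrow> ('i \<Rightarrow> ('g, 'm) monoid_scheme) \<Rightarrow> ('i \<times> 'g) set" where
  "fp_letters I G \<equiv> (SIGMA i:I. carrier (G i))"

definition fp_rel :: "'i set \<Rightarrow> ('i \<Rightarrow> ('g, 'm) monoid_scheme) \<Rightarrow> (('i \<times> 'g) list \<times> ('i \<times> 'g) list) set" where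
  "fp_rel I G = {([(i, g), (i, h)], [(i, g \<otimes>\<^bsub>G i\<^esub> h)]) | i g h.
      i \<in> I \<and> g \<in> carrier (G i) \<and> h \<in> carrier (G i)} \<union> {([(i, \<one>\<^bsub>G i\<^esub>)], []) | i. i \<in> I}"

lemma free_product_eq: "free_product I G = word_quotient (fp_letters I G) (fp_rel I G)"
  by (simp add: free_product_def fp_rel_def)

text \<open>The canonical embedding of the factor \<open>G i\<close>.\<close>

definition fp_emb :: "'i set \<Rightarrow> ('i \<Rightarrow> ('g, 'm) monoid_scheme) \<Rightarrow> 'i \<Rightarrow> 'g \<Rightarrow> ('i \<times> 'g) list set" where
  "fp_emb I G i g = word_cong (fp_letters I G) (fp_rel I G) `` {[(i, g)]}"

lemma fp_emb_hom:
  assumes "i \<in> I" and G: "\<And>i. i \<in> I \<Longrightarrow> group (G i)"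
  shows "fp_emb I G i \<in> hom (G i) (free_product I G)"
proof -
  interpret Gi: group "G i" using assms by blast
  show ?thesis
  proof (rule homI)
    fix g assume g: "g \<in> carrier (G i)"
    show "fp_emb I G i g \<in> carrier (free_product I G)"
      using assms(1) g unfolding fp_emb_def free_product_eq carrier_word_quotient by (auto intro!: quotientI)
    fix h assume h: "h \<in> carrier (G i)"
    have "([(i, g), (i, h)], [(i, g \<otimes>\<^bsub>G i\<^esub> h)]) \<in> fp_rel I G"
      using assms(1) g h unfolding fp_rel_def by blast
    from word_class_eq[OF this, of "fp_letters I G"]
    show "fp_emb I G i (g \<otimes>\<^bsub>G i\<^esub> h) = fp_emb I G i g \<otimes>\<^bsub>free_product I G\<^esub> fp_emb I G i h"
      using assms(1) g h unfolding fp_emb_def free_product_eq by (subst mult_word_quotient) auto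
  qed
qed

lemma fp_induct [consumes 1, case_names one emb]:
  assumes "c \<in> carrier (free_product I G)" and "P \<one>\<^bsub>free_product I G\<^esub>"
    and step: "\<And>c i g. c \<in> carrier (free_product I G) \<Longrightarrow> P c \<Longrightarrow> i \<in> I \<Longrightarrow> g \<in> carrier (G i) \<Longrightarrow>
      P (c \<otimes>\<^bsub>free_product I G\<^esub> fp_emb I G i g)"
  shows "P c"
proof -
  let ?cl = "\<lambda>w. word_cong (fp_letters I G) (fp_rel I G) `` {w}"
  have "P (?cl w)" if "w \<in> lists (fp_letters I G)" for w
    using that
  proof (induction w rule: rev_induct)
    case Nil
    then show ?case using assms(2) by (simp add: free_product_eq one_word_quotient)
  next
    case (snoc l w)
    obtain i g where l: "l = (i, g)" "i \<in> I" "g \<in> carrier (G i)" using snoc.prems by auto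
    have w: "w \<in> lists (fp_letters I G)" using snoc.prems by simp
    have "?cl w \<in> carrier (free_product I G)"
      using w unfolding free_product_eq carrier_word_quotient by (auto intro: quotientI)
    from step[OF this snoc.IH[OF w] l(2,3)] show ?case
      using w l unfolding fp_emb_def free_product_eq by (subst (asm) mult_word_quotient) auto
  qed
  then show ?thesis
    using assms(1) unfolding free_product_eq carrier_word_quotient by (metis quotientE)
qed

lemma (in group) fp_universal:
  assumes F: "\<And>i. i \<in> I \<Longrightarrow> group (F i)" and f: "\<And>i. i \<in> I \<Longrightarrow> f i \<in> hom (F i) G"
  obtains \<Phi> where "\<Phi> \<in> hom (free_product I F) G"
    and "\<And>i g. i \<in> I \<Longrightarrow> g \<in> carrier (F i) \<Longrightarrow> \<Phi> (fp_emb I F i g) = f i g"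
proof -
  let ?f = "\<lambda>(i, g). f i g"
  have one: "f i \<one>\<^bsub>F i\<^esub> = \<one>" if "i \<in> I" for i
    using hom_one[OF f[OF that] F[OF that] is_group] .
  have f': "?f \<in> fp_letters I F \<rightarrow> carrier G"
    using f by (auto simp: hom_def)
  have R: "fp_rel I F \<subseteq> lists (fp_letters I F) \<times> lists (fp_letters I F)"
    using F unfolding fp_rel_def
    by (auto intro!: monoid.m_closed[OF group.is_monoid] monoid.one_closed[OF group.is_monoid])
  have rel: "eval_word G ?f l = eval_word G ?f r" if "(l, r) \<in> fp_rel I F" for l r
    using that one unfolding fp_rel_def by (auto simp: hom_mult[OF f] hom_in_carrier[OF f])
  obtain \<phi> where \<phi>: "\<phi> \<in> hom (word_quotient (fp_letters I F) (fp_rel I F)) G"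
    "\<And>w. w \<in> lists (fp_letters I F) \<Longrightarrow>
      \<phi> (word_cong (fp_letters I F) (fp_rel I F) `` {w}) = eval_word G ?f w"
    using word_quotient_hom[OF f' R rel] by blast
  show thesis
  proof (rule that)
    show "\<phi> \<in> hom (free_product I F) G" using \<phi>(1) unfolding free_product_eq .
    show "\<phi> (fp_emb I F i g) = f i g" if "i \<in> I" "g \<in> carrier (F i)" for i g
      using \<phi>(2)[of "[(i, g)]"] that unfolding fp_emb_def by (auto simp: hom_in_carrier[OF f])
  qed
qed

text \<open>A free product of cyclic groups of odd order has no nontrivial homomorphism to the group of order two,
written here as the truth values with exclusive disjunction.\<close>

lemma free_product_of_odd_cyclic_no_parity:
  assumes "is_free_product_of_cyclic q K" "group K" "odd q"
    and F: "\<And>g h. g \<in> carrier K \<Longrightarrow> h \<in> carrier K \<Longrightarrow> F (g \<otimes>\<^bsub>K\<^esub> h) = (F g \<noteq> F h)"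
    and g: "g \<in> carrier K"
  shows "\<not> F g"
proof -
  interpret K: group K by fact
  let ?C = "\<lambda>_::nat. integer_mod_group q"
  obtain I :: "nat set" where "K \<cong> free_product I ?C"
    using assms(1) unfolding is_free_product_of_cyclic_def by blast
  then have "free_product I ?C \<cong> K" using K.iso_sym by blast
  then obtain \<theta> where \<theta>: "\<theta> \<in> iso (free_product I ?C) K" unfolding is_iso_def by blast
  interpret P: group "free_product I ?C" by (rule group_free_product) simp
  interpret \<theta>: group_hom "free_product I ?C" K \<theta>
    using \<theta> by unfold_locales (simp add: iso_def)
  have F1: "\<not> F \<one>\<^bsub>K\<^esub>" using F[of "\<one>\<^bsub>K\<^esub>" "\<one>\<^bsub>K\<^esub>"] by simp
  have pow: "F (u [^]\<^bsub>K\<^esub> m) = (odd m \<and> F u)" if "u \<in> carrier K" for u and m :: nat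
    by (induction m) (use that F F1 in auto)
  have letter: "\<not> F (\<theta> (fp_emb I ?C i j))" if i: "i \<in> I" and j: "j \<in> carrier (integer_mod_group q)" for i j
  proof -
    interpret e: group_hom "integer_mod_group q" "free_product I ?C" "fp_emb I ?C i"
      using fp_emb_hom[of i I ?C] i P.is_group
      by (intro group_hom.intro group_hom_axioms.intro) simp_all
    have "\<theta> (fp_emb I ?C i j) [^]\<^bsub>K\<^esub> q = \<theta> (fp_emb I ?C i (j [^]\<^bsub>integer_mod_group q\<^esub> q))"
      using j by (simp add: \<theta>.hom_nat_pow e.hom_nat_pow del: pow_integer_mod_group)
    also have "\<dots> = \<one>\<^bsub>K\<^esub>" using e.hom_one by simp
    finally show ?thesis using pow[of "\<theta> (fp_emb I ?C i j)" q] F1 assms(3) j by simp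
  qed
  have "\<not> F (\<theta> c)" if "c \<in> carrier (free_product I ?C)" for c
    using that
  proof (induction rule: fp_induct)
    case one
    then show ?case using F1 \<theta>.hom_one by simp
  next
    case (emb c i j)
    then have "fp_emb I ?C i j \<in> carrier (free_product I ?C)"
      using fp_emb_hom[of i I ?C] by (auto simp: hom_in_carrier)
    then show ?case using emb letter[of i j] F by simp
  qed
  moreover have "g \<in> \<theta> ` carrier (free_product I ?C)"
    using \<theta> g by (auto simp: iso_def bij_betw_def)
  ultimately show ?thesis by blast
qed

section \<open>Hecke groups\<close>

definition hecke_rel :: "nat \<Rightarrow> ((hecke_gen \<times> bool) list \<times> (hecke_gen \<times> bool) list) set" where
  "hecke_rel q = {([(s, b), (s, \<not> b)], []) | s b. s \<in> UNIV} \<union>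
     {(r, []) | r. r \<in> {replicate 2 (Gen_x, True), replicate q (Gen_y, True)}}"

definition hecke_class :: "nat \<Rightarrow> (hecke_gen \<times> bool) list \<Rightarrow> (hecke_gen \<times> bool) list set" where
  "hecke_class q w = word_cong (UNIV \<times> UNIV) (hecke_rel q) `` {w}"

lemma hecke_group_eq: "hecke_group q = word_quotient (UNIV \<times> UNIV) (hecke_rel q)"
  by (simp add: hecke_group_def presented_group_def hecke_rel_def)

lemma hecke_class_mult:
  "hecke_class q u \<otimes>\<^bsub>hecke_group q\<^esub> hecke_class q v = hecke_class q (u @ v)"
  unfolding hecke_class_def hecke_group_eq by (subst mult_word_quotient) auto

lemma hecke_class_Nil: "hecke_class q [] = \<one>\<^bsub>hecke_group q\<^esub>"
  unfolding hecke_class_def hecke_group_eq by (simp add: one_word_quotient)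

lemma hecke_class_closed: "hecke_class q w \<in> carrier (hecke_group q)"
  unfolding hecke_class_def hecke_group_eq carrier_word_quotient by (auto intro!: quotientI)

lemma hecke_class_cases:
  assumes "g \<in> carrier (hecke_group q)" obtains w where "g = hecke_class q w"
  using assms unfolding hecke_class_def hecke_group_eq carrier_word_quotient by (metis quotientE)

lemma hecke_class_rel: "(r, []) \<in> hecke_rel q \<Longrightarrow> hecke_class q r = \<one>\<^bsub>hecke_group q\<^esub>"
  unfolding hecke_class_Nil[symmetric] unfolding hecke_class_def by (rule word_class_eq) auto

lemma hecke_class_replicate:
  "hecke_class q (replicate m l) = hecke_class q [l] [^]\<^bsub>hecke_group q\<^esub> m"
proof -
  interpret group "hecke_group q" by (rule group_hecke_group)
  show ?thesis
  proof (induction m)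
    case (Suc m)
    have "hecke_class q (replicate (Suc m) l) = hecke_class q [l] \<otimes>\<^bsub>hecke_group q\<^esub> hecke_class q (replicate m l)"
      by (simp add: hecke_class_mult)
    then show ?case by (simp only: Suc nat_pow_Suc2 hecke_class_closed)
  qed (simp add: hecke_class_Nil)
qed

locale hecke = group G for G :: "(hecke_gen \<times> bool) list set monoid" (structure) +
  fixes q :: nat
  assumes G_eq: "G = hecke_group q" and prime_q: "Factorial_Ring.prime q" and odd_q: "odd q"
begin

definition gx where "gx = hecke_class q [(Gen_x, True)]"
definition gy where "gy = hecke_class q [(Gen_y, True)]"

lemma gx_closed [simp]: "gx \<in> carrier G" and gy_closed [simp]: "gy \<in> carrier G"
  unfolding gx_def gy_def G_eq by (rule hecke_class_closed)+

lemma q_pos [simp]: "q > 0" and q_ge_3: "q \<ge> 3"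
proof -
  show "q > 0" using odd_q by (cases q) auto
  show "q \<ge> 3" using prime_ge_2_nat[OF prime_q] odd_q by (cases "q = 2") auto
qed

lemma gx_gx [simp]: "gx \<otimes> gx = \<one>"
proof -
  have "hecke_class q (replicate 2 (Gen_x, True)) = \<one>"
    unfolding G_eq by (rule hecke_class_rel) (simp add: hecke_rel_def)
  then show ?thesis unfolding gx_def G_eq by (simp add: hecke_class_mult numeral_2_eq_2)
qed

lemma gy_pow_q [simp]: "gy [^] q = \<one>"
proof -
  have "hecke_class q (replicate q (Gen_y, True)) = \<one>"
    unfolding G_eq by (rule hecke_class_rel) (simp add: hecke_rel_def)
  then show ?thesis unfolding gy_def G_eq hecke_class_replicate .
qed

lemma gx_gx' [simp]: "g \<in> carrier G \<Longrightarrow> g \<otimes> gx \<otimes> gx = g"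
  by (simp add: m_assoc)

lemma gy_pow_mod: "gy [^] (i mod q) = gy [^] (i :: nat)"
proof -
  have "gy [^] i = gy [^] (q * (i div q) + i mod q)" by simp
  also have "\<dots> = (gy [^] q) [^] (i div q) \<otimes> gy [^] (i mod q)"
    by (simp only: nat_pow_mult[symmetric] nat_pow_pow gy_closed)
  finally show ?thesis by simp
qed

text \<open>Both generators have finite order, so every element is a product of generators without inverses.\<close>

lemma hecke_induct [consumes 1, case_names one x y]:
  assumes "g \<in> carrier G" and one: "P \<one>"
    and x: "\<And>g. g \<in> carrier G \<Longrightarrow> P g \<Longrightarrow> P (g \<otimes> gx)"
    and y: "\<And>g. g \<in> carrier G \<Longrightarrow> P g \<Longrightarrow> P (g \<otimes> gy)"
  shows "P g"
proof -
  have cl: "hecke_class q w \<in> carrier G" for w unfolding G_eq by (rule hecke_class_closed)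
  have inv: "hecke_class q [(s, True)] \<otimes> hecke_class q [(s, False)] = \<one>" for s
  proof -
    have "([(s, True), (s, False)], []) \<in> hecke_rel q"
      unfolding hecke_rel_def by (intro UnI1 CollectI exI[of _ s] exI[of _ True]) simp
    from hecke_class_rel[OF this] show ?thesis
      unfolding G_eq by (simp add: hecke_class_mult)
  qed
  have x': "hecke_class q [(Gen_x, False)] = gx"
    using inv[of Gen_x] gx_gx cl unfolding gx_def by (metis l_cancel)
  have "gy \<otimes> gy [^] (q - 1) = \<one>"
    using gy_pow_q nat_pow_Suc2[of gy "q - 1"] by simp
  then have y': "hecke_class q [(Gen_y, False)] = gy [^] (q - 1)"
    using inv[of Gen_y] cl gy_closed unfolding gy_def by (metis l_cancel nat_pow_closed)
  have ypow: "P (g \<otimes> gy [^] m)" if "g \<in> carrier G" "P g" for g and m :: nat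
    by (induction m) (use that y in \<open>auto simp: m_assoc[symmetric]\<close>)
  have "P (hecke_class q w)" for w
  proof (induction w rule: rev_induct)
    case Nil
    then show ?case using one G_eq by (simp add: hecke_class_Nil)
  next
    case (snoc l w)
    have e: "hecke_class q (w @ [l]) = hecke_class q w \<otimes> hecke_class q [l]"
      unfolding G_eq by (simp add: hecke_class_mult)
    show ?case
    proof (cases l)
      case (Pair s b)
      then show ?thesis unfolding e
        using x[OF cl snoc.IH] y[OF cl snoc.IH] ypow[OF cl snoc.IH] x' y'
        by (cases s; cases b) (auto simp flip: gx_def gy_def)
    qed
  qed
  then show ?thesis using assms(1) unfolding G_eq by (metis hecke_class_cases)
qed

lemma hecke_universal:
  assumes "monoid K" and a: "a \<in> carrier K" "a \<otimes>\<^bsub>K\<^esub> a = \<one>\<^bsub>K\<^esub>"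
    and b: "b \<in> carrier K" "b [^]\<^bsub>K\<^esub> q = \<one>\<^bsub>K\<^esub>"
  obtains \<phi> where "\<phi> \<in> hom G K" "\<phi> \<one> = \<one>\<^bsub>K\<^esub>" "\<phi> gx = a" "\<phi> gy = b"
proof -
  interpret K: monoid K by fact
  define f where "f l = (case l of (Gen_x, _) \<Rightarrow> a | (Gen_y, True) \<Rightarrow> b | (Gen_y, False) \<Rightarrow> b [^]\<^bsub>K\<^esub> (q - 1))" for l
  have f: "f \<in> UNIV \<times> UNIV \<rightarrow> carrier K"
    using a b unfolding f_def by (auto split: hecke_gen.splits bool.splits)
  have q: "Suc (q - 1) = q" using q_pos by simp
  have "b \<otimes>\<^bsub>K\<^esub> b [^]\<^bsub>K\<^esub> (q - 1) = \<one>\<^bsub>K\<^esub>" "b [^]\<^bsub>K\<^esub> (q - 1) \<otimes>\<^bsub>K\<^esub> b = \<one>\<^bsub>K\<^esub>"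
    using b K.nat_pow_Suc2[of b "q - 1"] K.nat_pow_Suc[of b "q - 1"] unfolding q by simp_all
  then have rel1: "eval_word K f [(s, c), (s, \<not> c)] = \<one>\<^bsub>K\<^esub>" for s c
    using a b unfolding f_def by (cases s; cases c) auto
  have rel: "eval_word K f l = eval_word K f r" if lr: "(l, r) \<in> hecke_rel q" for l r
  proof -
    consider s c where "l = [(s, c), (s, \<not> c)]" "r = []" | "l = replicate 2 (Gen_x, True)" "r = []"
      | "l = replicate q (Gen_y, True)" "r = []"
      using lr unfolding hecke_rel_def by blast
    then show ?thesis
    proof cases
      case 1
      then show ?thesis using rel1 by (simp del: eval_word_simps(2))
    next
      case 2
      then show ?thesis using a by (simp add: numeral_2_eq_2 f_def)
    next
      case 3
      then show ?thesis using b K.eval_word_replicate[of f "(Gen_y, True)" q] by (simp add: f_def)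
    qed
  qed
  obtain \<phi> where \<phi>: "\<phi> \<in> hom (word_quotient (UNIV \<times> UNIV) (hecke_rel q)) K"
    "\<And>w. w \<in> lists (UNIV \<times> UNIV) \<Longrightarrow> \<phi> (word_cong (UNIV \<times> UNIV) (hecke_rel q) `` {w}) = eval_word K f w"
    using K.word_quotient_hom[OF f _ rel] by auto
  have val: "\<phi> (hecke_class q w) = eval_word K f w" for w
    unfolding hecke_class_def by (rule \<phi>(2)) auto
  show thesis
  proof (rule that)
    show "\<phi> \<in> hom G K" using \<phi>(1) unfolding G_eq hecke_group_eq .
    show "\<phi> \<one> = \<one>\<^bsub>K\<^esub>" using val[of "[]"] unfolding G_eq hecke_class_Nil by simp
    show "\<phi> gx = a" "\<phi> gy = b" using val a b unfolding gx_def gy_def by (simp_all add: f_def)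
  qed
qed

end

section \<open>Labelled actions\<close>

text \<open>The wreath product with \<open>K\<close>: a pair \<open>(f, c)\<close> moves the point \<open>p\<close> to \<open>f p\<close> and
records the label \<open>c p\<close>. A product acts by its left factor first, and labels are multiplied in the
order in which they are recorded.\<close>

definition skew :: "('k, 'm) monoid_scheme \<Rightarrow> (('b \<Rightarrow> 'b) \<times> ('b \<Rightarrow> 'k)) monoid" where
  "skew K = \<lparr>carrier = {(f, c). \<forall>p. c p \<in> carrier K},
     monoid.mult = (\<lambda>(f, c) (f', c'). (f' \<circ> f, \<lambda>p. c p \<otimes>\<^bsub>K\<^esub> c' (f p))),
     one = (id, \<lambda>_. \<one>\<^bsub>K\<^esub>)\<rparr>"

lemma skew_simps [simp]:
  "(f, c) \<in> carrier (skew K) \<longleftrightarrow> (\<forall>p. c p \<in> carrier K)"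
  "(f, c) \<otimes>\<^bsub>skew K\<^esub> (f', c') = (f' \<circ> f, \<lambda>p. c p \<otimes>\<^bsub>K\<^esub> c' (f p))"
  "\<one>\<^bsub>skew K\<^esub> = (id, \<lambda>_. \<one>\<^bsub>K\<^esub>)"
  by (simp_all add: skew_def)

lemma monoid_skew:
  assumes "monoid K" shows "monoid (skew K :: (('b \<Rightarrow> 'b) \<times> ('b \<Rightarrow> 'k)) monoid)"
proof -
  interpret monoid K by fact
  show ?thesis by (rule monoidI) (auto simp: skew_def m_assoc fun_eq_iff)
qed

context hecke
begin

text \<open>A homomorphism from the Hecke group to the wreath product, split into a right action \<open>act\<close> and a
cocycle \<open>lab\<close>. The generator \<open>x\<close> acts as \<open>\<alpha>\<close> with labels \<open>\<xi>\<close>, and \<open>y\<close> as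
\<open>\<beta>\<close> with labels \<open>\<upsilon>\<close>.\<close>

definition labelled_action ::
  "('k, 'm) monoid_scheme \<Rightarrow> ('b \<Rightarrow> 'b) \<Rightarrow> ('b \<Rightarrow> 'k) \<Rightarrow> ('b \<Rightarrow> 'b) \<Rightarrow> ('b \<Rightarrow> 'k) \<Rightarrow>
   ((hecke_gen \<times> bool) list set \<Rightarrow> 'b \<Rightarrow> 'b) \<Rightarrow> ((hecke_gen \<times> bool) list set \<Rightarrow> 'b \<Rightarrow> 'k) \<Rightarrow> bool" where
  "labelled_action K \<alpha> \<xi> \<beta> \<upsilon> act lab \<longleftrightarrow>
     act \<one> = id \<and> lab \<one> = (\<lambda>_. \<one>\<^bsub>K\<^esub>) \<and> act gx = \<alpha> \<and> lab gx = \<xi> \<and> act gy = \<beta> \<and> lab gy = \<upsilon> \<and>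
     (\<forall>g\<in>carrier G. \<forall>p. lab g p \<in> carrier K) \<and>
     (\<forall>g\<in>carrier G. \<forall>h\<in>carrier G. act (g \<otimes> h) = act h \<circ> act g \<and>
        lab (g \<otimes> h) = (\<lambda>p. lab g p \<otimes>\<^bsub>K\<^esub> lab h (act g p)))"

lemma labelled_action_exists:
  fixes K :: "('k, 'm) monoid_scheme" and \<alpha> \<beta> :: "'b \<Rightarrow> 'b"
  assumes "monoid K" and \<alpha>: "\<And>p. \<alpha> (\<alpha> p) = p" and \<beta>: "\<And>p. (\<beta> ^^ q) p = p"
    and \<xi>: "\<And>p. \<xi> p \<in> carrier K" "\<And>p. \<xi> p \<otimes>\<^bsub>K\<^esub> \<xi> (\<alpha> p) = \<one>\<^bsub>K\<^esub>"
    and \<upsilon>: "\<And>p. \<upsilon> p \<in> carrier K"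
      "\<And>p. (\<beta> p = p \<and> \<upsilon> p [^]\<^bsub>K\<^esub> q = \<one>\<^bsub>K\<^esub>) \<or> (\<forall>j. \<upsilon> ((\<beta> ^^ j) p) = \<one>\<^bsub>K\<^esub>)"
  shows "\<exists>act lab. labelled_action K \<alpha> \<xi> \<beta> \<upsilon> act lab"
proof -
  interpret K: monoid K by fact
  interpret S: monoid "skew K :: (('b \<Rightarrow> 'b) \<times> ('b \<Rightarrow> 'k)) monoid"
    by (rule monoid_skew) fact
  have pow: "(\<beta>, \<upsilon>) [^]\<^bsub>skew K\<^esub> m =
      (\<beta> ^^ m, \<lambda>p. if \<beta> p = p \<and> \<upsilon> p [^]\<^bsub>K\<^esub> q = \<one>\<^bsub>K\<^esub> then \<upsilon> p [^]\<^bsub>K\<^esub> m else \<one>\<^bsub>K\<^esub>)" for m :: nat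
  proof (induction m)
    case (Suc m)
    have fixp: "(\<beta> ^^ m) p = p" if "\<beta> p = p" for p
      using that by (induction m) auto
    show ?case
      using \<upsilon> fixp by (auto simp: Suc fun_eq_iff)
  qed (simp add: fun_eq_iff)
  have "\<upsilon> p [^]\<^bsub>K\<^esub> q = \<one>\<^bsub>K\<^esub>" if "\<beta> p = p" for p
    using \<upsilon>(2)[of p] by (metis K.nat_pow_one funpow_0)
  then have Yq: "(\<beta>, \<upsilon>) [^]\<^bsub>skew K\<^esub> q = \<one>\<^bsub>skew K\<^esub>"
    unfolding pow using \<beta> by (auto simp: fun_eq_iff)
  obtain \<phi> where \<phi>: "\<phi> \<in> hom G (skew K)" "\<phi> \<one> = \<one>\<^bsub>skew K\<^esub>" "\<phi> gx = (\<alpha>, \<xi>)" "\<phi> gy = (\<beta>, \<upsilon>)"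
  proof (rule hecke_universal[of "skew K" "(\<alpha>, \<xi>)" "(\<beta>, \<upsilon>)"])
    show "monoid (skew K :: (('b \<Rightarrow> 'b) \<times> ('b \<Rightarrow> 'k)) monoid)" by (rule monoid_skew) fact
  qed (use \<alpha> \<xi> \<upsilon> Yq in \<open>auto simp: fun_eq_iff\<close>)
  have "labelled_action K \<alpha> \<xi> \<beta> \<upsilon> (\<lambda>g. fst (\<phi> g)) (\<lambda>g. snd (\<phi> g))"
    unfolding labelled_action_def
  proof (intro conjI ballI allI)
    fix g p assume g: "g \<in> carrier G"
    then show "snd (\<phi> g) p \<in> carrier K"
      using hom_in_carrier[OF \<phi>(1) g] by (auto simp: skew_def)
    fix h assume h: "h \<in> carrier G"
    show "fst (\<phi> (g \<otimes> h)) = fst (\<phi> h) \<circ> fst (\<phi> g)"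
      "snd (\<phi> (g \<otimes> h)) = (\<lambda>p. snd (\<phi> g) p \<otimes>\<^bsub>K\<^esub> snd (\<phi> h) (fst (\<phi> g) p))"
      unfolding hom_mult[OF \<phi>(1) g h] by (auto simp: skew_def split: prod.splits)
  qed (use \<phi> in auto)
  then show ?thesis by blast
qed

end

section \<open>Plane trees and their darts\<close>

text \<open>A finite plane tree all of whose vertices have degree \<open>1\<close> or \<open>k + 1\<close>, with a distinguished
directed edge, is encoded by the set \<open>M\<close> of its vertices of degree \<open>k + 1\<close> (the internal
vertices). The end points of the distinguished edge are \<open>[0]\<close> and \<open>[1]\<close>; away from this
edge, an internal vertex \<open>u\<close> has the children \<open>i # u\<close> for \<open>i < k\<close>. Thus \<open>vertices k M\<close>
are all the vertices, leaves included, and \<open>M\<close> is legitimate if \<open>M \<subseteq> vertices k M\<close>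
(\<open>is_forest\<close>, as deleting the distinguished edge leaves two rooted trees; \<open>M\<close> may be infinite).\<close>

definition vertices :: "nat \<Rightarrow> nat list set \<Rightarrow> nat list set" where
  "vertices k M = {[0], [1]} \<union> {i # u | i u. i < k \<and> u \<in> M}"

definition is_forest :: "nat \<Rightarrow> nat list set \<Rightarrow> bool" where
  "is_forest k M \<longleftrightarrow> M \<subseteq> vertices k M"

text \<open>A dart is a directed edge, written as its initial vertex and its position there: position \<open>0\<close>
points to the parent (for the roots, to the other root) and position \<open>Suc i\<close> to the child
\<open>i # v\<close>. So a leaf has one dart, and an internal vertex has \<open>q\<close> darts when \<open>k = q - 1\<close>.\<close>

definition darts :: "nat \<Rightarrow> nat list set \<Rightarrow> (nat list \<times> nat) set" where
  "darts q M = {(v, i). v \<in> vertices (q - 1) M \<and> (i = 0 \<or> v \<in> M \<and> i < q)}"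

lemma Nil_notin_vertices [simp]: "[] \<notin> vertices k M"
  by (simp add: vertices_def)

lemma Nil_notin_forest: "is_forest k M \<Longrightarrow> [] \<notin> M"
  unfolding is_forest_def using Nil_notin_vertices by blast

lemma Cons_in_vertices:
  "[] \<notin> M \<Longrightarrow> i # u \<in> vertices k M \<longleftrightarrow> (if u = [] then i < 2 else i < k \<and> u \<in> M)"
  unfolding vertices_def by auto

lemma forests_eq: "forests k {[0], [1]} t = {M. finite M \<and> card M = t \<and> is_forest k M}"
  unfolding forests_def is_forest_def vertices_def by (intro Collect_cong) blast

text \<open>The permutations by which the generators of the Hecke group act on darts: \<open>flip\<close> reverses a
directed edge, and does not depend on the tree; \<open>rot q M\<close> turns around the initial vertex. Both are
extended to permutations of the whole type, with arbitrary values away from the darts.\<close>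

fun flip :: "nat list \<times> nat \<Rightarrow> nat list \<times> nat" where
  "flip ([], i) = ([], i)"
| "flip (a # u, Suc i) = (i # a # u, 0)"
| "flip ([a], 0) = ([if a = 0 then 1 else if a = 1 then 0 else a], 0)"
| "flip (a # b # u, 0) = (b # u, Suc a)"

definition rot :: "nat \<Rightarrow> nat list set \<Rightarrow> nat list \<times> nat \<Rightarrow> nat list \<times> nat" where
  "rot q M p = (if fst p \<in> M \<and> snd p < q then (fst p, Suc (snd p) mod q) else p)"

lemma flip_flip [simp]: "flip (flip p) = p"
  by (induction p rule: flip.induct) auto

lemma rot_pow: "q > 0 \<Longrightarrow>
    (rot q M ^^ j) (v, i) = (if v \<in> M \<and> i < q then (v, (i + j) mod q) else (v, i))"
  by (induction j) (auto simp: rot_def mod_Suc_eq)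

lemma rot_pow_q: "q > 0 \<Longrightarrow> (rot q M ^^ q) p = p"
  by (cases p) (simp add: rot_pow)

lemma darts_root: "([0], 0) \<in> darts q M"
  by (simp add: darts_def vertices_def)

lemma flip_darts:
  assumes "is_forest (q - 1) M" "p \<in> darts q M" shows "flip p \<in> darts q M"
proof -
  have "[] \<notin> M" using Nil_notin_forest assms(1) .
  moreover have "M \<subseteq> vertices (q - 1) M" using assms(1) by (simp add: is_forest_def)
  ultimately show ?thesis
    using assms(2) by (cases p rule: flip.cases) (auto simp: darts_def Cons_in_vertices split: if_splits)
qed

lemma rot_darts: "q > 0 \<Longrightarrow> p \<in> darts q M \<Longrightarrow> rot q M p \<in> darts q M"
  by (cases p) (auto simp: darts_def rot_def)

lemma finite_darts_imp:
  assumes "finite (darts q M)" "is_forest (q - 1) M" shows "finite M"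
proof -
  have "(\<lambda>v. (v, 0)) ` M \<subseteq> darts q M" using assms(2) by (auto simp: darts_def is_forest_def)
  then have "finite ((\<lambda>v. (v, 0 :: nat)) ` M)" using assms(1) finite_subset by blast
  then show ?thesis by (rule finite_imageD) (simp add: inj_on_def)
qed

lemma card_darts:
  assumes "finite M" "is_forest (q - 1) M" "q > 0"
  shows "finite (darts q M)" "card (darts q M) = 2 + 2 * (q - 1) * card M"
proof -
  let ?C = "(\<lambda>(i, u). i # u) ` ({..<q - 1} \<times> M)"
  have V: "vertices (q - 1) M = {[0], [1]} \<union> ?C" by (auto simp: vertices_def)
  have "{[0], [1]} \<inter> ?C = {}" using Nil_notin_forest[OF assms(2)] by auto
  moreover have "card ?C = (q - 1) * card M"
    by (subst card_image) (auto simp: inj_on_def card_cartesian_product)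
  ultimately have V': "finite (vertices (q - 1) M)" "card (vertices (q - 1) M) = 2 + (q - 1) * card M"
    unfolding V using assms(1) by (simp_all add: card_Un_disjoint)
  have D: "darts q M = vertices (q - 1) M \<times> {0} \<union> M \<times> {1..<q}"
    using assms(2) by (auto simp: darts_def is_forest_def)
  show "finite (darts q M)" unfolding D using V' assms(1) by simp
  have "card (darts q M) = card (vertices (q - 1) M \<times> {0::nat}) + card (M \<times> {1..<q})"
    unfolding D using V' assms(1) by (intro card_Un_disjoint) auto
  then show "card (darts q M) = 2 + 2 * (q - 1) * card M"
    using V' by (simp add: card_cartesian_product)
qed

section \<open>Subgroups from trees\<close>

lemma (in group) rcos_eq_iff:
  assumes "subgroup H G" "a \<in> carrier G" "b \<in> carrier G"
  shows "H #> a = H #> b \<longleftrightarrow> (\<exists>h\<in>H. a = h \<otimes> b)"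
proof
  assume "H #> a = H #> b"
  then have "a \<in> H #> b" using rcos_self[OF assms(2,1)] by simp
  then show "\<exists>h\<in>H. a = h \<otimes> b" unfolding r_coset_def by blast
next
  assume "\<exists>h\<in>H. a = h \<otimes> b"
  then have "a \<in> H #> b" unfolding r_coset_def by blast
  from repr_independence[OF this assms(3,1)] show "H #> a = H #> b" by simp
qed

context hecke
begin

lemma carrier_mod_q: "carrier (integer_mod_group q) = {0..<int q}"
  using q_pos by (simp add: carrier_integer_mod_group)

text \<open>The element of the Hecke group read along the path from the dart \<open>([0], 0)\<close> to \<open>(v, 0)\<close>,
and more generally to an arbitrary dart. It does not depend on the tree.\<close>

fun vertex_elt :: "nat list \<Rightarrow> (hecke_gen \<times> bool) list set" where
  "vertex_elt [] = \<one>"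
| "vertex_elt [a] = (if a = 0 then \<one> else gx)"
| "vertex_elt (i # a # u) = vertex_elt (a # u) \<otimes> gy [^] Suc i \<otimes> gx"

lemma vertex_elt_closed [simp]: "vertex_elt v \<in> carrier G"
  by (induction v rule: vertex_elt.induct) auto

definition dart_elt :: "nat list \<times> nat \<Rightarrow> (hecke_gen \<times> bool) list set" where
  "dart_elt p = vertex_elt (fst p) \<otimes> gy [^] snd p"

lemma dart_elt_closed [simp]: "dart_elt p \<in> carrier G"
  by (simp add: dart_elt_def)

lemma dart_elt_root [simp]: "dart_elt ([0], 0) = \<one>"
  by (simp add: dart_elt_def)

lemma dart_elt_flip:
  assumes "is_forest (q - 1) M" "p \<in> darts q M"
  shows "dart_elt (flip p) = dart_elt p \<otimes> gx"
  using assms(2) Nil_notin_forest[OF assms(1)]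
  by (cases p rule: flip.cases) (auto simp: dart_elt_def darts_def Cons_in_vertices)

lemma dart_elt_rot: "fst p \<in> M \<Longrightarrow> snd p < q \<Longrightarrow> dart_elt (rot q M p) = dart_elt p \<otimes> gy"
  using gy_pow_mod[of "Suc (snd p)"] by (simp add: dart_elt_def rot_def m_assoc)

definition leaves :: "nat list set \<Rightarrow> nat list set" where
  "leaves M = vertices (q - 1) M - M"

lemma dart_cases:
  assumes "p \<in> darts q M"
  obtains "fst p \<in> M" "snd p < q" | v where "p = (v, 0)" "v \<in> leaves M"
proof (cases "fst p \<in> M")
  case True
  then have "snd p < q" using assms q_pos by (cases p) (auto simp: darts_def)
  then show thesis using that(1) True by blast
next
  case False
  then have "p = (fst p, 0)" "fst p \<in> leaves M"
    using assms by (cases p; auto simp: darts_def leaves_def)+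
  then show thesis using that(2) by blast
qed

text \<open>The free product of cyclic groups of order \<open>q\<close>, one for each leaf. The definition of the
subgroups that are counted requires index sets of natural numbers, hence the encoding \<open>to_nat\<close>.\<close>

abbreviation leaf_index :: "nat list set \<Rightarrow> nat set" where
  "leaf_index M \<equiv> to_nat ` leaves M"

abbreviation leaf_product :: "nat list set \<Rightarrow> (nat \<times> int) list set monoid" where
  "leaf_product M \<equiv> free_product (leaf_index M) (\<lambda>_. integer_mod_group q)"

definition leaf_gen :: "nat list set \<Rightarrow> nat list \<Rightarrow> (nat \<times> int) list set" where
  "leaf_gen M v = fp_emb (leaf_index M) (\<lambda>_. integer_mod_group q) (to_nat v) 1"

text \<open>Labels for the action: turning around a leaf is recorded by the generator belonging to this leaf, all
other steps have trivial label.\<close>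

definition leaf_label :: "nat list set \<Rightarrow> nat list \<times> nat \<Rightarrow> (nat \<times> int) list set" where
  "leaf_label M p = (if snd p = 0 \<and> fst p \<in> leaves M then leaf_gen M (fst p) else \<one>\<^bsub>leaf_product M\<^esub>)"

lemma group_leaf_product: "group (leaf_product M)"
  by (rule group_free_product) simp

lemma leaf_emb_hom:
  "v \<in> leaves M \<Longrightarrow> group_hom (integer_mod_group q) (leaf_product M)
     (fp_emb (leaf_index M) (\<lambda>_. integer_mod_group q) (to_nat v))"
  using fp_emb_hom[of "to_nat v" "leaf_index M" "\<lambda>_. integer_mod_group q"] group_leaf_product
  by (intro group_hom.intro group_hom_axioms.intro) simp_all

lemma leaf_gen:
  assumes "v \<in> leaves M"
  shows "leaf_gen M v \<in> carrier (leaf_product M)"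
    and "j \<in> carrier (integer_mod_group q) \<Longrightarrow>
      fp_emb (leaf_index M) (\<lambda>_. integer_mod_group q) (to_nat v) j = leaf_gen M v [^]\<^bsub>leaf_product M\<^esub> nat j"
    and "leaf_gen M v [^]\<^bsub>leaf_product M\<^esub> q = \<one>\<^bsub>leaf_product M\<^esub>"
proof -
  interpret e: group_hom "integer_mod_group q" "leaf_product M"
    "fp_emb (leaf_index M) (\<lambda>_. integer_mod_group q) (to_nat v)"
    by (rule leaf_emb_hom) fact
  have 1: "1 \<in> carrier (integer_mod_group q)" using q_ge_3 by simp
  show "leaf_gen M v \<in> carrier (leaf_product M)"
    unfolding leaf_gen_def using 1 by (rule e.hom_closed)
  have pow: "leaf_gen M v [^]\<^bsub>leaf_product M\<^esub> m =
      fp_emb (leaf_index M) (\<lambda>_. integer_mod_group q) (to_nat v) (int m mod int q)" for m :: nat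
    unfolding leaf_gen_def e.hom_nat_pow[OF 1, symmetric] by simp
  show "leaf_gen M v [^]\<^bsub>leaf_product M\<^esub> q = \<one>\<^bsub>leaf_product M\<^esub>"
    using e.hom_one by (simp add: pow)
  show "fp_emb (leaf_index M) (\<lambda>_. integer_mod_group q) (to_nat v) j =
      leaf_gen M v [^]\<^bsub>leaf_product M\<^esub> nat j"
    if "j \<in> carrier (integer_mod_group q)"
    using that q_pos by (auto simp: pow carrier_mod_q)
qed

lemma leaf_label_internal: "fst p \<in> M \<Longrightarrow> leaf_label M p = \<one>\<^bsub>leaf_product M\<^esub>"
  unfolding leaf_label_def by (simp add: leaves_def)

lemma leaf_label_closed: "leaf_label M p \<in> carrier (leaf_product M)"
  using leaf_gen(1) group.is_monoid[OF group_leaf_product[of M]]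
  by (auto simp: leaf_label_def monoid.one_closed)

lemma tree_action_exists:
  "\<exists>act lab. labelled_action (leaf_product M) flip (\<lambda>_. \<one>\<^bsub>leaf_product M\<^esub>) (rot q M) (leaf_label M) act lab"
proof -
  interpret P: group "leaf_product M" by (rule group_leaf_product)
  show ?thesis
  proof (rule labelled_action_exists)
    fix p :: "nat list \<times> nat"
    obtain v i where p: "p = (v, i)" by (cases p)
    show "(rot q M p = p \<and> leaf_label M p [^]\<^bsub>leaf_product M\<^esub> q = \<one>\<^bsub>leaf_product M\<^esub>) \<or>
        (\<forall>j. leaf_label M ((rot q M ^^ j) p) = \<one>\<^bsub>leaf_product M\<^esub>)"
    proof (cases "v \<in> leaves M \<and> i = 0")
      case True
      then show ?thesis using leaf_gen(3)[of v M] by (simp add: p rot_def leaves_def leaf_label_def)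
    next
      case False
      then have "leaf_label M ((rot q M ^^ j) p) = \<one>\<^bsub>leaf_product M\<^esub>" for j
        by (auto simp: p rot_pow leaf_label_internal) (auto simp: leaf_label_def)
      then show ?thesis by blast
    qed
  qed (auto simp: P.is_monoid rot_pow_q leaf_label_closed)
qed

text \<open>The action on darts, and the label in the free product that is collected on the way.\<close>

definition tree_act where
  "tree_act M = (SOME act. \<exists>lab. labelled_action (leaf_product M) flip (\<lambda>_. \<one>\<^bsub>leaf_product M\<^esub>)
     (rot q M) (leaf_label M) act lab)"

definition tree_lab where
  "tree_lab M = (SOME lab. labelled_action (leaf_product M) flip (\<lambda>_. \<one>\<^bsub>leaf_product M\<^esub>)
     (rot q M) (leaf_label M) (tree_act M) lab)"

lemma tree_action: "labelled_action (leaf_product M) flip (\<lambda>_. \<one>\<^bsub>leaf_product M\<^esub>)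
    (rot q M) (leaf_label M) (tree_act M) (tree_lab M)"
proof -
  have "\<exists>lab. labelled_action (leaf_product M) flip (\<lambda>_. \<one>\<^bsub>leaf_product M\<^esub>)
    (rot q M) (leaf_label M) (tree_act M) lab"
    using someI_ex[OF tree_action_exists[of M]] unfolding tree_act_def .
  then show ?thesis unfolding tree_lab_def by (rule someI_ex)
qed

lemma tree_act_simps [simp]:
  "tree_act M \<one> p = p" "tree_act M gx p = flip p" "tree_act M gy p = rot q M p"
  "g \<in> carrier G \<Longrightarrow> h \<in> carrier G \<Longrightarrow> tree_act M (g \<otimes> h) p = tree_act M h (tree_act M g p)"
  using tree_action[of M] by (simp_all add: labelled_action_def)

lemma tree_lab_simps [simp]:
  "tree_lab M \<one> p = \<one>\<^bsub>leaf_product M\<^esub>" "tree_lab M gx p = \<one>\<^bsub>leaf_product M\<^esub>"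
  "tree_lab M gy p = leaf_label M p" "g \<in> carrier G \<Longrightarrow> tree_lab M g p \<in> carrier (leaf_product M)"
  "g \<in> carrier G \<Longrightarrow> h \<in> carrier G \<Longrightarrow>
     tree_lab M (g \<otimes> h) p = tree_lab M g p \<otimes>\<^bsub>leaf_product M\<^esub> tree_lab M h (tree_act M g p)"
  using tree_action[of M] unfolding labelled_action_def by (blast | simp)+

lemma tree_act_gy_pow: "tree_act M (gy [^] (j::nat)) p = (rot q M ^^ j) p"
  by (induction j) auto

lemma tree_lab_gy_pow:
  assumes "v \<in> M" "i < q" shows "tree_lab M (gy [^] (j::nat)) (v, i) = \<one>\<^bsub>leaf_product M\<^esub>"
proof -
  interpret P: group "leaf_product M" by (rule group_leaf_product)
  show ?thesis
    by (induction j) (simp_all add: assms tree_act_gy_pow rot_pow leaf_label_internal)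
qed

lemma tree_act_inv:
  assumes "g \<in> carrier G"
  shows "tree_act M (inv g) (tree_act M g p) = p"
  using tree_act_simps(4)[of g "inv g" M p] assms by simp

lemma vertex_elt_act:
  assumes "is_forest (q - 1) M" "v \<in> vertices (q - 1) M"
  shows "tree_act M (vertex_elt v) ([0], 0) = (v, 0) \<and> tree_lab M (vertex_elt v) ([0], 0) = \<one>\<^bsub>leaf_product M\<^esub>"
  using assms(2)
proof (induction v rule: vertex_elt.induct)
  case 1
  then show ?case by simp
next
  case (2 a)
  then show ?case using Nil_notin_forest[OF assms(1)]
    by (auto simp: Cons_in_vertices)
next
  case (3 i a u)
  interpret P: group "leaf_product M" by (rule group_leaf_product)
  have au: "a # u \<in> M" "Suc i < q"
    using 3(2) Nil_notin_forest[OF assms(1)] by (auto simp: Cons_in_vertices)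
  then have "a # u \<in> vertices (q - 1) M" using assms(1) by (auto simp: is_forest_def)
  note IH = 3(1)[OF this]
  show ?case
    using IH au tree_lab_gy_pow[OF au(1), of 0 "Suc i"] tree_act_gy_pow[of M "Suc i" "(a # u, 0)"]
      rot_pow[OF q_pos, where M = M and j = "Suc i" and v = "a # u" and i = 0]
    by (simp del: nat_pow_Suc funpow.simps)
qed

lemma dart_elt_act:
  assumes "is_forest (q - 1) M" "p \<in> darts q M"
  shows "tree_act M (dart_elt p) ([0], 0) = p"
proof -
  obtain v i where p: "p = (v, i)" by (cases p)
  then have v: "v \<in> vertices (q - 1) M" "i = 0 \<or> v \<in> M \<and> i < q"
    using assms(2) by (auto simp: darts_def)
  then show ?thesis
    using vertex_elt_act[OF assms(1) v(1)] by (auto simp: p dart_elt_def tree_act_gy_pow rot_pow)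
qed

text \<open>The stabiliser of the distinguished dart.\<close>

definition tree_stab :: "nat list set \<Rightarrow> (hecke_gen \<times> bool) list set set" where
  "tree_stab M = {g \<in> carrier G. tree_act M g ([0], 0) = ([0], 0)}"

lemma subgroup_tree_stab: "subgroup (tree_stab M) G"
proof (rule subgroupI)
  fix g assume "g \<in> tree_stab M"
  then show "inv g \<in> tree_stab M"
    using tree_act_inv[of g M "([0], 0)"] by (simp add: tree_stab_def)
qed (auto simp: tree_stab_def intro!: exI[of _ \<one>])

text \<open>Every group element is the product of the element read off its label and the element of the dart that
it reaches. For elements of the stabiliser the second factor is trivial, so the label determines
them.\<close>

lemma walk_label:
  assumes M: "is_forest (q - 1) M" and \<Phi>: "\<Phi> \<in> hom (leaf_product M) G"
    and \<Phi>_gen: "\<And>v. v \<in> leaves M \<Longrightarrow> \<Phi> (leaf_gen M v) = vertex_elt v \<otimes> gy \<otimes> inv (vertex_elt v)"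
    and g: "g \<in> carrier G"
  shows "tree_act M g ([0], 0) \<in> darts q M \<and>
    \<Phi> (tree_lab M g ([0], 0)) \<otimes> dart_elt (tree_act M g ([0], 0)) = g"
  using g
proof (induction rule: hecke_induct)
  interpret \<Phi>: group_hom "leaf_product M" G \<Phi>
    using \<Phi> group_leaf_product is_group by (intro group_hom.intro group_hom_axioms.intro)
  {
    case one
    then show ?case using darts_root \<Phi>.hom_one by simp
  next
    case (x g)
    let ?p = "tree_act M g ([0], 0)"
    let ?c = "\<Phi> (tree_lab M g ([0], 0))"
    have "?c \<otimes> (dart_elt ?p \<otimes> gx) = (?c \<otimes> dart_elt ?p) \<otimes> gx"
      using x by (simp add: m_assoc[symmetric])
    then show ?case using x flip_darts[OF M] dart_elt_flip[OF M] by simp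
  next
    case (y g)
    let ?p = "tree_act M g ([0], 0)"
    let ?c = "tree_lab M g ([0], 0)"
    have c: "?c \<in> carrier (leaf_product M)" using y by simp
    have p: "rot q M ?p \<in> darts q M" using y by (intro rot_darts) auto
    from conjunct1[OF y.IH] show ?case
    proof (cases rule: dart_cases)
      case 1
      have "\<Phi> ?c \<otimes> (dart_elt ?p \<otimes> gy) = (\<Phi> ?c \<otimes> dart_elt ?p) \<otimes> gy"
        using y by (simp add: m_assoc[symmetric])
      moreover have "leaf_label M ?p = \<one>\<^bsub>leaf_product M\<^esub>"
        using 1 by (simp add: leaf_label_internal)
      ultimately show ?thesis using y p dart_elt_rot[OF 1] c by simp
    next
      case (2 v)
      have "v \<notin> M" using 2 by (simp add: leaves_def)
      then have r: "rot q M ?p = ?p" using 2 by (simp add: rot_def)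
      have "\<Phi> (?c \<otimes>\<^bsub>leaf_product M\<^esub> leaf_gen M v) \<otimes> vertex_elt v = (\<Phi> ?c \<otimes> vertex_elt v) \<otimes> gy"
        using \<Phi>_gen[OF 2(2)] leaf_gen(1)[OF 2(2)] c by (simp add: m_assoc)
      moreover have "leaf_label M ?p = leaf_gen M v" using 2 by (simp add: leaf_label_def)
      moreover have "dart_elt ?p = vertex_elt v" using 2 by (simp add: dart_elt_def)
      ultimately show ?thesis using y r by simp
    qed
  }
qed

lemma leaf_hom:
  obtains \<Phi> where "\<Phi> \<in> hom (leaf_product M) G"
    "\<And>v. v \<in> leaves M \<Longrightarrow> \<Phi> (leaf_gen M v) = vertex_elt v \<otimes> gy \<otimes> inv (vertex_elt v)"
proof -
  define f where "f i j = vertex_elt (from_nat i) \<otimes> gy [^] nat j \<otimes> inv (vertex_elt (from_nat i))" for i and j :: int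
  have f: "f i \<in> hom (integer_mod_group q) G" for i
  proof (rule homI)
    fix a b assume "a \<in> carrier (integer_mod_group q)" "b \<in> carrier (integer_mod_group q)"
    then have ab: "a \<ge> 0" "b \<ge> 0" by (auto simp: carrier_mod_q)
    have "gy [^] nat ((a + b) mod int q) = gy [^] nat a \<otimes> gy [^] nat b"
      using ab gy_pow_mod[of "nat a + nat b"] by (simp only: nat_pow_mult[OF gy_closed] nat_mod_distrib nat_add_distrib nat_int add_nonneg_nonneg of_nat_0_le_iff)
    moreover have "vertex_elt v \<otimes> (c \<otimes> d) \<otimes> inv (vertex_elt v) = (vertex_elt v \<otimes> c \<otimes> inv (vertex_elt v)) \<otimes> (vertex_elt v \<otimes> d \<otimes> inv (vertex_elt v))"
      if "c \<in> carrier G" "d \<in> carrier G" for v c d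
    proof -
      have "inv (vertex_elt v) \<otimes> (vertex_elt v \<otimes> (d \<otimes> inv (vertex_elt v))) = d \<otimes> inv (vertex_elt v)"
        using that by (simp add: m_assoc[symmetric])
      then show ?thesis using that by (simp add: m_assoc)
    qed
    ultimately show "f i (a \<otimes>\<^bsub>integer_mod_group q\<^esub> b) = f i a \<otimes> f i b" by (simp add: f_def)
  qed (simp add: f_def)
  obtain \<Phi> where \<Phi>: "\<Phi> \<in> hom (leaf_product M) G"
    "\<And>i g. i \<in> leaf_index M \<Longrightarrow> g \<in> carrier (integer_mod_group q) \<Longrightarrow>
      \<Phi> (fp_emb (leaf_index M) (\<lambda>_. integer_mod_group q) i g) = f i g"
    using fp_universal[of "leaf_index M" "\<lambda>_. integer_mod_group q" f] f by auto
  show thesis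
  proof (rule that[OF \<Phi>(1)])
    fix v assume "v \<in> leaves M"
    then show "\<Phi> (leaf_gen M v) = vertex_elt v \<otimes> gy \<otimes> inv (vertex_elt v)"
      unfolding leaf_gen_def using \<Phi>(2)[of "to_nat v" 1] q_ge_3 by (simp add: f_def)
  qed
qed

lemma tree_act_darts:
  assumes "is_forest (q - 1) M" "g \<in> carrier G"
  shows "tree_act M g ([0], 0) \<in> darts q M"
  using walk_label[OF assms(1) _ _ assms(2)] leaf_hom by metis

text \<open>The action on darts is transitive, so the cosets of the stabiliser correspond to the darts.\<close>

lemma index_tree_stab:
  assumes M: "is_forest (q - 1) M"
  shows "card (rcosets (tree_stab M)) = card (darts q M)"
proof -
  note sub = subgroup_tree_stab[of M]
  have eq: "tree_stab M #> a = tree_stab M #> b \<longleftrightarrow> tree_act M a ([0], 0) = tree_act M b ([0], 0)"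
    if ab: "a \<in> carrier G" "b \<in> carrier G" for a b
  proof
    assume "tree_stab M #> a = tree_stab M #> b"
    then obtain h where "h \<in> tree_stab M" "a = h \<otimes> b"
      using rcos_eq_iff[OF sub ab] by blast
    then show "tree_act M a ([0], 0) = tree_act M b ([0], 0)"
      using ab by (simp add: tree_stab_def)
  next
    assume "tree_act M a ([0], 0) = tree_act M b ([0], 0)"
    then have "a \<otimes> inv b \<in> tree_stab M"
      using ab tree_act_inv[of b M] by (simp add: tree_stab_def)
    moreover have "a = (a \<otimes> inv b) \<otimes> b" using ab by (simp add: m_assoc)
    ultimately show "tree_stab M #> a = tree_stab M #> b"
      using rcos_eq_iff[OF sub ab] by blast
  qed
  have "bij_betw (\<lambda>p. tree_stab M #> dart_elt p) (darts q M) (rcosets (tree_stab M))"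
  proof (rule bij_betwI')
    fix p p' assume "p \<in> darts q M" "p' \<in> darts q M"
    then show "tree_stab M #> dart_elt p = tree_stab M #> dart_elt p' \<longleftrightarrow> p = p'"
      using eq dart_elt_act[OF M] by simp
  next
    fix p show "tree_stab M #> dart_elt p \<in> rcosets (tree_stab M)"
      by (simp add: RCOSETS_def) (use dart_elt_closed in blast)
  next
    fix C assume "C \<in> rcosets (tree_stab M)"
    then obtain g where g: "g \<in> carrier G" "C = tree_stab M #> g" unfolding RCOSETS_def by blast
    then show "\<exists>p\<in>darts q M. C = tree_stab M #> dart_elt p"
      using tree_act_darts[OF M g(1)] eq dart_elt_act[OF M] by (metis dart_elt_closed)
  qed
  then show ?thesis by (rule bij_betw_same_card[symmetric])
qed

text \<open>The label map is an isomorphism from the stabiliser to the free product. It is injective by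
\<open>walk_label\<close>, and the loop that walks to the leaf \<open>v\<close>, turns around it and comes back is
mapped to the generator that belongs to \<open>v\<close>.\<close>

lemma tree_stab_iso:
  assumes M: "is_forest (q - 1) M"
  shows "is_free_product_of_cyclic q (G\<lparr>carrier := tree_stab M\<rparr>)"
proof -
  let ?K = "G\<lparr>carrier := tree_stab M\<rparr>"
  let ?\<psi> = "\<lambda>g. tree_lab M g ([0], 0)"
  interpret P: group "leaf_product M" by (rule group_leaf_product)
  interpret K: group ?K using subgroup_tree_stab subgroup.subgroup_is_group by blast
  have K: "g \<in> carrier G" "tree_act M g ([0], 0) = ([0], 0)" if "g \<in> carrier ?K" for g
    using that by (auto simp: tree_stab_def)
  interpret \<psi>: group_hom ?K "leaf_product M" ?\<psi>
    by (intro group_hom.intro group_hom_axioms.intro homI) (use K K.is_group P.is_group in auto)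
  obtain \<Phi> where \<Phi>: "\<Phi> \<in> hom (leaf_product M) G"
    "\<And>v. v \<in> leaves M \<Longrightarrow> \<Phi> (leaf_gen M v) = vertex_elt v \<otimes> gy \<otimes> inv (vertex_elt v)"
    using leaf_hom by blast
  interpret \<Phi>: group_hom "leaf_product M" G \<Phi>
    using \<Phi> group_leaf_product is_group by (intro group_hom.intro group_hom_axioms.intro)
  have inverse: "\<Phi> (?\<psi> g) = g" if "g \<in> carrier ?K" for g
    using walk_label[OF M \<Phi> K(1)[OF that]] K[OF that] by simp
  have surj: "\<exists>h\<in>carrier ?K. ?\<psi> h = c" if "c \<in> carrier (leaf_product M)" for c
    using that
  proof (induction rule: fp_induct)
    case one
    show ?case by (rule bexI[of _ \<one>]) (auto simp: tree_stab_def)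
  next
    case (emb c i j)
    then obtain h v where h: "h \<in> carrier ?K" "?\<psi> h = c" and v: "v \<in> leaves M" "i = to_nat v" by blast
    define u where "u = vertex_elt v \<otimes> gy \<otimes> inv (vertex_elt v)"
    have v': "v \<in> vertices (q - 1) M" "v \<notin> M" using v by (auto simp: leaves_def)
    note Wv = vertex_elt_act[OF M v'(1)]
    have r: "rot q M (v, 0) = (v, 0)" using v' by (simp add: rot_def)
    have "tree_lab M (vertex_elt v \<otimes> inv (vertex_elt v)) ([0], 0) = \<one>\<^bsub>leaf_product M\<^esub>" by simp
    then have "tree_lab M (inv (vertex_elt v)) (v, 0) = \<one>\<^bsub>leaf_product M\<^esub>"
      by (subst (asm) tree_lab_simps(5)) (simp_all add: Wv)
    moreover have "tree_act M (inv (vertex_elt v)) (v, 0) = ([0], 0)"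
      using tree_act_inv[of "vertex_elt v" M "([0], 0)"] Wv by simp
    ultimately have u: "u \<in> carrier ?K" "?\<psi> u = leaf_gen M v"
      using Wv r leaf_gen(1)[OF v(1)] v(1) by (simp_all add: u_def tree_stab_def leaf_label_def)
    have "?\<psi> (h \<otimes>\<^bsub>?K\<^esub> u [^]\<^bsub>?K\<^esub> nat j) = c \<otimes>\<^bsub>leaf_product M\<^esub> leaf_gen M v [^]\<^bsub>leaf_product M\<^esub> nat j"
      using h u \<psi>.hom_mult[of h "u [^]\<^bsub>?K\<^esub> nat j"] \<psi>.hom_nat_pow[of u "nat j"] K.nat_pow_closed[of u "nat j"] by presburger
    then show ?case
      using leaf_gen(2)[OF v(1)] emb h u v K.m_closed K.nat_pow_closed by metis
  qed
  have "?\<psi> \<in> iso ?K (leaf_product M)"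
    unfolding iso_def bij_betw_def
  proof (intro CollectI conjI)
    show "?\<psi> \<in> hom ?K (leaf_product M)" by (rule \<psi>.homh)
    show "inj_on ?\<psi> (carrier ?K)" using inverse by (metis inj_on_inverseI)
    show "?\<psi> ` carrier ?K = carrier (leaf_product M)" using surj \<psi>.hom_closed by blast
  qed
  then show ?thesis unfolding is_free_product_of_cyclic_def is_iso_def by blast
qed

end

section \<open>The tree of a subgroup\<close>

context hecke
begin

text \<open>The coset \<open>H #> vertex_elt v\<close> is the point of the coset graph reached by reading the vertex \<open>v\<close>;
the vertex branches if \<open>y\<close> moves this point.\<close>

definition branching :: "(hecke_gen \<times> bool) list set set \<Rightarrow> nat list \<Rightarrow> bool" where
  "branching H v \<longleftrightarrow> H #> (vertex_elt v \<otimes> gy) \<noteq> H #> vertex_elt v"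

text \<open>Unfolding the coset graph of \<open>H\<close> from the coset \<open>H\<close>: a vertex is internal if it branches
and its parent (if any) is internal. The result is the set \<open>tree_of H\<close>, which may be infinite for
a general subgroup.\<close>

primrec in_tree :: "(hecke_gen \<times> bool) list set set \<Rightarrow> nat list \<Rightarrow> bool" where
  "in_tree H [] = False"
| "in_tree H (i # u) = (branching H (i # u) \<and> (if u = [] then i < 2 else i < q - 1 \<and> in_tree H u))"

definition tree_of :: "(hecke_gen \<times> bool) list set set \<Rightarrow> nat list set" where
  "tree_of H = {v. in_tree H v}"

lemma is_forest_tree_of: "is_forest (q - 1) (tree_of H)"
  unfolding is_forest_def
proof
  fix v assume "v \<in> tree_of H"
  then show "v \<in> vertices (q - 1) (tree_of H)"
    by (cases v) (auto simp: tree_of_def Cons_in_vertices)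
qed

lemma in_tree_of_iff:
  assumes "v \<in> vertices (q - 1) (tree_of H)" shows "v \<in> tree_of H \<longleftrightarrow> branching H v"
  using assms by (cases v) (auto simp: tree_of_def Cons_in_vertices)

lemma tree_of_tree_stab:
  assumes M: "is_forest (q - 1) M"
  shows "tree_of (tree_stab M) = M"
proof -
  have Nil: "[] \<notin> M" using Nil_notin_forest M .
  have V: "M \<subseteq> vertices (q - 1) M" using M by (simp add: is_forest_def)
  have br: "branching (tree_stab M) v \<longleftrightarrow> v \<in> M" if v: "v \<in> vertices (q - 1) M" for v
  proof -
    have "tree_stab M #> (vertex_elt v \<otimes> gy) = tree_stab M #> vertex_elt v \<longleftrightarrow>
        (vertex_elt v \<otimes> gy) \<otimes> inv (vertex_elt v) \<in> tree_stab M"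
    proof
      assume "tree_stab M #> (vertex_elt v \<otimes> gy) = tree_stab M #> vertex_elt v"
      then obtain h where "h \<in> tree_stab M" "vertex_elt v \<otimes> gy = h \<otimes> vertex_elt v"
        using rcos_eq_iff[OF subgroup_tree_stab, of "vertex_elt v \<otimes> gy" "vertex_elt v"] by auto
      then show "(vertex_elt v \<otimes> gy) \<otimes> inv (vertex_elt v) \<in> tree_stab M"
        by (simp add: tree_stab_def m_assoc)
    next
      assume *: "(vertex_elt v \<otimes> gy) \<otimes> inv (vertex_elt v) \<in> tree_stab M"
      have "vertex_elt v \<otimes> gy = ((vertex_elt v \<otimes> gy) \<otimes> inv (vertex_elt v)) \<otimes> vertex_elt v" by (simp add: m_assoc)
      then show "tree_stab M #> (vertex_elt v \<otimes> gy) = tree_stab M #> vertex_elt v"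
        using rcos_eq_iff[OF subgroup_tree_stab, of "vertex_elt v \<otimes> gy" "vertex_elt v"] * by auto
    qed
    also have "\<dots> \<longleftrightarrow> tree_act M (inv (vertex_elt v)) (rot q M (v, 0)) = ([0], 0)"
      using vertex_elt_act[OF M v] by (simp add: tree_stab_def)
    also have "\<dots> \<longleftrightarrow> rot q M (v, 0) = (v, 0)"
    proof
      assume "tree_act M (inv (vertex_elt v)) (rot q M (v, 0)) = ([0], 0)"
      then have "tree_act M (vertex_elt v) (tree_act M (inv (vertex_elt v)) (rot q M (v, 0))) = (v, 0)"
        using vertex_elt_act[OF M v] by simp
      then show "rot q M (v, 0) = (v, 0)"
        using tree_act_inv[of "inv (vertex_elt v)" M] by simp
    next
      assume "rot q M (v, 0) = (v, 0)"
      then show "tree_act M (inv (vertex_elt v)) (rot q M (v, 0)) = ([0], 0)"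
        using tree_act_inv[of "vertex_elt v" M "([0], 0)"] vertex_elt_act[OF M v] by simp
    qed
    also have "\<dots> \<longleftrightarrow> v \<notin> M" using q_ge_3 by (auto simp: rot_def)
    finally show ?thesis unfolding branching_def by blast
  qed
  have "in_tree (tree_stab M) v \<longleftrightarrow> v \<in> M" for v
  proof (induction v)
    case (Cons i u)
    show ?case
    proof (cases "i # u \<in> vertices (q - 1) M")
      case True
      then show ?thesis using Cons br[OF True] Nil by (auto simp: Cons_in_vertices)
    next
      case False
      then show ?thesis using Cons V Nil by (auto simp: Cons_in_vertices split: if_splits)
    qed
  qed (use Nil in simp)
  then show ?thesis by (auto simp: tree_of_def)
qed

text \<open>The map sending a dart \<open>p\<close> to the coset of \<open>dart_elt p\<close> commutes with the action of the
Hecke group, so walking in the tree is walking in the coset graph. For arbitrary \<open>H\<close> it need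
not be injective.\<close>

lemma coset_walk:
  assumes H: "subgroup H G" and g: "g \<in> carrier G"
  defines "M \<equiv> tree_of H"
  shows "tree_act M g ([0], 0) \<in> darts q M \<and> H #> dart_elt (tree_act M g ([0], 0)) = H #> g"
  using g
proof (induction rule: hecke_induct)
  have M: "is_forest (q - 1) M" unfolding M_def by (rule is_forest_tree_of)
  have Hc: "H \<subseteq> carrier G" using H subgroup.subset by blast
  {
    case one
    then show ?case using darts_root by simp
  next
    case (x g)
    then show ?case using flip_darts[OF M] dart_elt_flip[OF M]
      by (simp add: coset_mult_assoc[OF Hc, symmetric])
  next
    case (y g)
    let ?p = "tree_act M g ([0], 0)"
    have p: "rot q M ?p \<in> darts q M" using y by (intro rot_darts) auto
    have Hy: "H #> (dart_elt ?p \<otimes> gy) = H #> (g \<otimes> gy)"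
      using y by (simp add: coset_mult_assoc[OF Hc, symmetric])
    from conjunct1[OF y.IH] show ?case
    proof (cases rule: dart_cases)
      case 1
      then show ?thesis using y p Hy dart_elt_rot[OF 1] by simp
    next
      case (2 v)
      then have v: "v \<notin> M" "v \<in> vertices (q - 1) M" by (auto simp: leaves_def)
      then have "H #> (dart_elt ?p \<otimes> gy) = H #> dart_elt ?p"
        using in_tree_of_iff[of v H] 2(1) unfolding M_def branching_def by (simp add: dart_elt_def)
      moreover have "rot q M ?p = ?p" using v 2 by (simp add: rot_def)
      ultimately show ?thesis using y Hy p by simp
    qed
  }
qed

end

section \<open>Cutting the coset graph along an edge\<close>

locale cyclic_product_subgroup = hecke +
  fixes H
  assumes sub: "subgroup H G" and cyc: "is_free_product_of_cyclic q (G\<lparr>carrier := H\<rparr>)"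
begin

lemma H_closed [simp]: "h \<in> H \<Longrightarrow> h \<in> carrier G"
  using subgroup.mem_carrier[OF sub] .

text \<open>The coset graph has the cosets of \<open>H\<close> as points, and an edge \<open>{Ha, Hax}\<close> for every coset;
\<open>y\<close> joins cosets without crossing an edge. A set \<open>E\<close> of edges is given here by the union of its
cosets. A cut along \<open>E\<close> is a two-colouring of the points (a function on the group that is constant
on cosets of \<open>H\<close>) whose colour changes exactly when an edge of \<open>E\<close> is crossed.\<close>

definition is_cut :: "(hecke_gen \<times> bool) list set set \<Rightarrow> ((hecke_gen \<times> bool) list set \<Rightarrow> bool) \<Rightarrow> bool" where
  "is_cut E F \<longleftrightarrow> (\<forall>g\<in>carrier G. F (g \<otimes> gx) = (F g \<noteq> (g \<in> E)) \<and> F (g \<otimes> gy) = F g \<and>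
     (\<forall>h\<in>H. F (h \<otimes> g) = F g))"

text \<open>Counting the crossings of \<open>E\<close> modulo two along a walk gives a cocycle, and its restriction to
\<open>H\<close> is a homomorphism to the group of order two. It vanishes because \<open>H\<close> is generated by
elements of odd order \<open>q\<close>; so the colour of the end of a walk depends on its end coset only.\<close>

lemma cut_exists:
  assumes Ex: "\<And>g. g \<in> carrier G \<Longrightarrow> g \<otimes> gx \<in> E \<longleftrightarrow> g \<in> E"
    and EH: "\<And>g h. g \<in> carrier G \<Longrightarrow> h \<in> H \<Longrightarrow> h \<otimes> g \<in> E \<longleftrightarrow> g \<in> E"
    and Ec: "E \<subseteq> carrier G"
  shows "\<exists>F. is_cut E F"
proof -
  let ?K = "\<lparr>carrier = UNIV, monoid.mult = (\<noteq>), one = False\<rparr> :: bool monoid"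
  \<comment> \<open>Right translations, extended by the identity outside of the group so that they are permutations
    of the whole type.\<close>
  define s where "s a g = (if g \<in> carrier G then g \<otimes> a else g)" for a g
  have spow: "(s gy ^^ j) g = (if g \<in> carrier G then g \<otimes> gy [^] j else g)" for g j
    by (induction j) (auto simp: s_def m_assoc)
  have "\<exists>act lab. labelled_action ?K (s gx) (\<lambda>g. g \<in> E) (s gy) (\<lambda>_. False) act lab"
  proof (rule labelled_action_exists)
    show "monoid ?K" by (rule monoidI) auto
  qed (use Ex Ec in \<open>auto simp: spow s_def\<close>)
  then obtain act lab where A: "labelled_action ?K (s gx) (\<lambda>g. g \<in> E) (s gy) (\<lambda>_. False) act lab"
    by blast
  have one: "act \<one> = id" "lab \<one> p = False"
    and mult: "g \<in> carrier G \<Longrightarrow> h \<in> carrier G \<Longrightarrow> act (g \<otimes> h) = act h \<circ> act g"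
    "g \<in> carrier G \<Longrightarrow> h \<in> carrier G \<Longrightarrow> lab (g \<otimes> h) p = (lab g p \<noteq> lab h (act g p))"
    and gen: "act gx = s gx" "act gy = s gy" "lab gx p = (p \<in> E)" "lab gy p = False" for p g h
    using A unfolding labelled_action_def by auto
  have act: "act g a = a \<otimes> g" if "g \<in> carrier G" "a \<in> carrier G" for g a
    using that(1)
  proof (induction rule: hecke_induct)
    case one
    then show ?case using that \<open>act \<one> = id\<close> by simp
  qed (use that mult gen in \<open>auto simp: s_def m_assoc\<close>)
  have lab_H: "lab g h = lab g \<one>" if "g \<in> carrier G" "h \<in> H" for g h
    using that(1)
  proof (induction rule: hecke_induct)
    case one
    then show ?case using \<open>\<And>p. lab \<one> p = False\<close> by simp
  next
    case (x g)
    then show ?case using that(2) mult gen act EH[of g h] by simp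
  next
    case (y g)
    then show ?case using that(2) mult gen act by simp
  qed
  have hom: "lab (h \<otimes> g) \<one> = (lab h \<one> \<noteq> lab g \<one>)" if "h \<in> H" "g \<in> carrier G" for h g
    using that mult act lab_H[of g h] by simp
  have triv: "\<not> lab h \<one>" if "h \<in> H" for h
    by (rule free_product_of_odd_cyclic_no_parity[OF cyc _ odd_q, of "\<lambda>g. lab g \<one>"])
      (use hom that subgroup.subgroup_is_group[OF sub is_group] in auto)
  have "is_cut E (\<lambda>g. lab g \<one>)"
    unfolding is_cut_def using mult gen act hom triv by simp
  then show ?thesis by blast
qed

text \<open>The edge at the coset \<open>Ha\<close>, and the cut along this single edge. The edge and hence the cut are the
same for \<open>a\<close> and \<open>ax\<close>. The existence of a cut shows that every edge is a bridge, and in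
particular that \<open>Hax \<noteq> Ha\<close>.\<close>

definition edge where
  "edge a = (H #> a) \<union> (H #> (a \<otimes> gx))"

definition cut where
  "cut a = (SOME F. is_cut (edge a) F)"

lemma mem_rcos: "a \<in> carrier G \<Longrightarrow> g \<in> carrier G \<Longrightarrow> g \<in> H #> a \<longleftrightarrow> H #> g = H #> a"
  using rcos_self[OF _ sub] repr_independence[OF _ _ sub] by metis

lemma rcos_left: "h \<in> H \<Longrightarrow> g \<in> carrier G \<Longrightarrow> H #> (h \<otimes> g) = H #> g"
  using rcos_eq_iff[OF sub, of "h \<otimes> g" g] by auto

lemma rcos_right: 
  assumes "a \<in> carrier G" "b \<in> carrier G" "c \<in> carrier G"
  shows "H #> (a \<otimes> c) = H #> (b \<otimes> c) \<longleftrightarrow> H #> a = H #> b"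
proof -
  have "(\<exists>h\<in>H. a \<otimes> c = h \<otimes> (b \<otimes> c)) \<longleftrightarrow> (\<exists>h\<in>H. a = h \<otimes> b)"
    using assms by (simp add: m_assoc[symmetric])
  then show ?thesis using rcos_eq_iff[OF sub] assms by simp
qed

lemma mem_edge:
  assumes "a \<in> carrier G" "g \<in> carrier G"
  shows "g \<in> edge a \<longleftrightarrow> H #> g = H #> a \<or> H #> g = H #> (a \<otimes> gx)"
  using mem_rcos assms by (simp add: edge_def)

lemma cut:
  assumes a: "a \<in> carrier G"
  shows "is_cut (edge a) (cut a)"
proof -
  have "\<exists>F. is_cut (edge a) F"
  proof (rule cut_exists)
    show "edge a \<subseteq> carrier G"
      using a sub by (simp add: edge_def r_coset_subset_G subgroup.subset)
    fix g assume g: "g \<in> carrier G"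
    show "g \<otimes> gx \<in> edge a \<longleftrightarrow> g \<in> edge a"
      using rcos_right[of g "a \<otimes> gx" gx] rcos_right[of g a gx] a g by (auto simp: mem_edge)
    show "h \<otimes> g \<in> edge a \<longleftrightarrow> g \<in> edge a" if "h \<in> H" for h
      using a g that by (simp add: mem_edge rcos_left)
  qed
  then show ?thesis unfolding cut_def by (rule someI_ex)
qed

lemma cut_simps:
  assumes "a \<in> carrier G" "g \<in> carrier G"
  shows "cut a (g \<otimes> gx) = (cut a g \<noteq> (g \<in> edge a))" "cut a (g \<otimes> gy) = cut a g"
    "h \<in> H \<Longrightarrow> cut a (h \<otimes> g) = cut a g"
  using cut[OF assms(1)] assms(2) unfolding is_cut_def by blast+

lemma cut_gy_pow: "a \<in> carrier G \<Longrightarrow> g \<in> carrier G \<Longrightarrow> cut a (g \<otimes> gy [^] (m::nat)) = cut a g"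
proof (induction m)
  case (Suc m)
  then show ?case using cut_simps(2)[of a "g \<otimes> gy [^] m"] by (simp add: m_assoc)
qed simp

lemma cut_rcos:
  assumes "a \<in> carrier G" "g \<in> carrier G" "g' \<in> carrier G" "H #> g = H #> g'"
  shows "cut a g = cut a g'"
proof -
  obtain h where "h \<in> H" "g = h \<otimes> g'" using rcos_eq_iff[OF sub assms(2,3)] assms(4) by blast
  then show ?thesis using cut_simps(3)[OF assms(1,3)] by simp
qed

lemma cut_gx: "a \<in> carrier G \<Longrightarrow> cut (a \<otimes> gx) = cut a"
  unfolding cut_def edge_def by (simp add: Un_commute)

lemma cut_self_gx: "a \<in> carrier G \<Longrightarrow> cut a (a \<otimes> gx) \<noteq> cut a a"
  using cut_simps(1)[of a a] mem_edge[of a a] by simp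

text \<open>Let \<open>Ha\<close> and \<open>Hb\<close> be distinct cosets in one orbit of \<open>y\<close>. The parts of the graph that lie
beyond the edges at these cosets are disjoint: a walk that starts at \<open>a\<close> can leave the near side of
one edge only through that edge, at a coset that is on the near side of the other.\<close>

lemma cuts_disjoint:
  assumes a: "a \<in> carrier G" and b: "b = a \<otimes> gy [^] (m::nat)" and ne: "H #> a \<noteq> H #> b"
    and g: "g \<in> carrier G"
  shows "cut a g = cut a a \<or> cut b g = cut b b"
proof -
  have bc: "b \<in> carrier G" using a b by simp
  have ab: "cut a b = cut a a" "cut b b = cut b a" using cut_gy_pow a bc b by auto
  have hit: "H #> g = H #> c" if "c \<in> carrier G" "g \<in> carrier G" "cut c g = cut c c" "g \<in> edge c" for c g
    using that mem_edge[of c g] cut_rcos[of c g "c \<otimes> gx"] cut_self_gx[of c] by auto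
  have "cut a (a \<otimes> g) = cut a a \<or> cut b (a \<otimes> g) = cut b b" if "g \<in> carrier G" for g
    using that
  proof (induction rule: hecke_induct)
    case one
    then show ?case using a by simp
  next
    case (x g)
    define s where "s = a \<otimes> g"
    have s: "s \<in> carrier G" "a \<otimes> (g \<otimes> gx) = s \<otimes> gx" using x a by (simp_all add: s_def m_assoc)
    have IH: "cut a s = cut a a \<or> cut b s = cut b b" using x by (simp add: s_def)
    show ?case
    proof (rule ccontr)
      assume "\<not> ?case"
      then have n: "cut a (s \<otimes> gx) \<noteq> cut a a" "cut b (s \<otimes> gx) \<noteq> cut b b" using s by auto
      note sx = cut_simps(1)[OF a s(1)] cut_simps(1)[OF bc s(1)]
      from IH show False
      proof
        assume 1: "cut a s = cut a a"
        then have "s \<in> edge a" using n sx by auto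
        then have sa: "H #> s = H #> a" using hit[OF a s(1) 1] by simp
        then have 2: "cut b s = cut b b" using cut_rcos[OF bc s(1) a] ab by simp
        then have "s \<in> edge b" using n sx by auto
        then show False using hit[OF bc s(1) 2] sa ne by simp
      next
        assume 1: "cut b s = cut b b"
        then have "s \<in> edge b" using n sx by auto
        then have sb: "H #> s = H #> b" using hit[OF bc s(1) 1] by simp
        then have 2: "cut a s = cut a a" using cut_rcos[OF a s(1) bc] ab by simp
        then have "s \<in> edge a" using n sx by auto
        then show False using hit[OF a s(1) 2] sb ne by simp
      qed
    qed
  next
    case (y g)
    then show ?case using cut_simps(2)[OF a, of "a \<otimes> g"] cut_simps(2)[OF bc, of "a \<otimes> g"] a
      by (simp add: m_assoc)
  qed
  from this[of "inv a \<otimes> g"] show ?thesis using a g by (simp add: m_assoc[symmetric])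
qed

abbreviation "tree_H \<equiv> tree_of H"

text \<open>Since \<open>q\<close> is prime, an orbit of \<open>y\<close> on the cosets has \<open>1\<close> or \<open>q\<close> points.\<close>

lemma rcos_gy_pow:
  assumes a: "a \<in> carrier G" and m: "0 < m" "m < q" and eq: "H #> (a \<otimes> gy [^] m) = H #> a"
  shows "H #> (a \<otimes> gy) = H #> a"
proof -
  have step: "H #> (a \<otimes> gy [^] (m * e)) = H #> a" for e
  proof (induction e)
    case (Suc e)
    have "H #> (a \<otimes> gy [^] (m * Suc e)) = H #> ((a \<otimes> gy [^] (m * e)) \<otimes> gy [^] m)"
      using a by (simp add: m_assoc nat_pow_mult add.commute)
    also have "\<dots> = H #> (a \<otimes> gy [^] m)"
      using rcos_right Suc a by simp
    finally show ?case using eq by simp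
  qed (use a in simp)
  have "coprime m q"
    using prime_imp_coprime[OF prime_q, of m] m by (simp add: coprime_commute nat_dvd_not_less)
  then obtain e f where "m * e = q * f + 1" using bezout_nat[of m q] m(1) by auto
  then have "(m * e) mod q = 1 mod q" by (simp only: mod_mult_self4)
  then have "gy [^] (m * e) = gy"
    using gy_pow_mod[of "m * e"] gy_pow_mod[of 1] by simp
  then show ?thesis using step[of e] by simp
qed

lemma branching_slots:
  assumes v: "v \<in> tree_H" and ij: "i < q" "j < q" and eq: "H #> (vertex_elt v \<otimes> gy [^] i) = H #> (vertex_elt v \<otimes> gy [^] j)"
  shows "i = j"
proof -
  have br: "H #> (vertex_elt v \<otimes> gy) \<noteq> H #> vertex_elt v"
    using v is_forest_tree_of in_tree_of_iff[of v H] unfolding branching_def is_forest_def by blast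
  have *: False if ij: "i < j" "j < q" and eq: "H #> (vertex_elt v \<otimes> gy [^] i) = H #> (vertex_elt v \<otimes> gy [^] j)" for i j
  proof -
    have "gy [^] j = gy [^] (j - i) \<otimes> gy [^] i" using ij by (simp add: nat_pow_mult)
    then have "vertex_elt v \<otimes> gy [^] j = (vertex_elt v \<otimes> gy [^] (j - i)) \<otimes> gy [^] i" by (simp add: m_assoc)
    then have "H #> vertex_elt v = H #> (vertex_elt v \<otimes> gy [^] (j - i))" using eq rcos_right by simp
    then show False using rcos_gy_pow[of "vertex_elt v" "j - i"] br ij by simp
  qed
  show ?thesis using *[of i j] *[of j i] ij eq by (cases i j rule: linorder_cases) auto
qed

text \<open>The part of the coset graph on the side of \<open>vertex_elt v\<close> of the edge at \<open>H #> vertex_elt v\<close>. It contains the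
images of all darts at \<open>v\<close> and at the descendants of \<open>v\<close>.\<close>

definition region where
  "region v = {g \<in> carrier G. cut (vertex_elt v) g = cut (vertex_elt v) (vertex_elt v)}"

lemma region_child:
  assumes "i # v \<in> vertices (q - 1) tree_H" "v \<noteq> []"
  defines "r \<equiv> vertex_elt v \<otimes> gy [^] Suc i"
  shows "region (i # v) = {g \<in> carrier G. cut r g \<noteq> cut r r}" "Suc i < q" "v \<in> tree_H"
proof -
  show "Suc i < q" "v \<in> tree_H"
    using assms(1,2) Nil_notin_forest[OF is_forest_tree_of] by (auto simp: Cons_in_vertices)
  have "vertex_elt (i # v) = r \<otimes> gx" using assms(2) unfolding r_def by (cases v) simp_all
  moreover have r: "r \<in> carrier G" by (simp add: r_def)
  ultimately show "region (i # v) = {g \<in> carrier G. cut r g \<noteq> cut r r}"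
    using cut_gx[OF r] cut_self_gx[OF r] unfolding region_def by auto
qed

lemma dart_in_region: "dart_elt (v, i) \<in> region v"
  by (simp add: region_def dart_elt_def cut_gy_pow)

lemma region_child_subset:
  assumes "i # v \<in> vertices (q - 1) tree_H" "v \<noteq> []"
  shows "region (i # v) \<subseteq> region v"
proof -
  note c = region_child[OF assms]
  have "H #> vertex_elt v \<noteq> H #> (vertex_elt v \<otimes> gy [^] Suc i)"
    using branching_slots[OF c(3), of 0 "Suc i"] c(2) by (auto simp del: nat_pow_Suc)
  note disj = cuts_disjoint[OF vertex_elt_closed refl this]
  show ?thesis
  proof
    fix g assume "g \<in> region (i # v)"
    then have "g \<in> carrier G" "cut (vertex_elt v \<otimes> gy [^] Suc i) g \<noteq> cut (vertex_elt v \<otimes> gy [^] Suc i) (vertex_elt v \<otimes> gy [^] Suc i)"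
      unfolding c(1) by blast+
    then show "g \<in> region v" using disj[of g] unfolding region_def by blast
  qed
qed

lemma region_child_parent:
  assumes "i # v \<in> vertices (q - 1) tree_H" "v \<noteq> []"
  shows "dart_elt (v, j) \<notin> region (i # v)"
proof -
  let ?r = "vertex_elt v \<otimes> gy [^] Suc i"
  have "cut ?r (vertex_elt v \<otimes> gy [^] j) = cut ?r (vertex_elt v)" "cut ?r ?r = cut ?r (vertex_elt v)"
    by (rule cut_gy_pow; simp)+
  then show ?thesis unfolding region_child(1)[OF assms] dart_elt_def by simp
qed

lemma region_siblings:
  assumes "i # v \<in> vertices (q - 1) tree_H" "j # v \<in> vertices (q - 1) tree_H" "v \<noteq> []"
    and g: "g \<in> region (i # v)" "g \<in> region (j # v)"
  shows "i = j"
proof -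
  let ?r = "\<lambda>i. vertex_elt v \<otimes> gy [^] Suc i"
  note ci = region_child[OF assms(1,3)] and cj = region_child[OF assms(2,3)]
  have "Suc i + (q - Suc i + Suc j) = q + Suc j" using ci(2) by simp
  then have "gy [^] Suc i \<otimes> gy [^] (q - Suc i + Suc j) = gy [^] q \<otimes> gy [^] Suc j"
    by (simp only: nat_pow_mult gy_closed)
  then have "?r j = ?r i \<otimes> gy [^] (q - Suc i + Suc j)"
    by (simp add: m_assoc del: nat_pow_Suc)
  moreover have "?r i \<in> carrier G" by simp
  moreover have "g \<in> carrier G" "cut (?r i) g \<noteq> cut (?r i) (?r i)" "cut (?r j) g \<noteq> cut (?r j) (?r j)"
    using g unfolding ci(1) cj(1) by blast+
  ultimately have "H #> ?r i = H #> ?r j"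
    using cuts_disjoint[of "?r i" "?r j" "q - Suc i + Suc j" g] by blast
  then show "i = j" using branching_slots[OF ci(3) ci(2) cj(2)] by simp
qed

lemma vertices_tail:
  assumes "i # v \<in> vertices (q - 1) tree_H" "v \<noteq> []" shows "v \<in> vertices (q - 1) tree_H"
  using region_child(3)[OF assms] is_forest_tree_of[of H] by (auto simp: is_forest_def)

lemma region_suffix_mono:
  assumes "suffix v u" "v \<noteq> []" "u \<in> vertices (q - 1) tree_H"
  shows "region u \<subseteq> region v \<and> v \<in> vertices (q - 1) tree_H"
  using assms
proof (induction u)
  case (Cons i u)
  show ?case
  proof (cases "v = i # u")
    case False
    then have s: "suffix v u" "u \<noteq> []" using Cons.prems by (auto simp: suffix_Cons)
    then show ?thesis
      using Cons.IH[OF s(1)] Cons.prems vertices_tail region_child_subset by blast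
  qed (use Cons.prems in simp)
qed simp

text \<open>Regions of distinct siblings are disjoint, and the region of a child is contained in the region of
its parent but misses the darts at the parent. Hence the regions containing the image of a dart at
\<open>u\<close> are those of the ancestors of \<open>u\<close> (and of \<open>u\<close> itself).\<close>

lemma dart_region_suffix:
  assumes "v \<in> vertices (q - 1) tree_H" "u \<in> vertices (q - 1) tree_H" "dart_elt (u, i) \<in> region v"
  shows "suffix v u"
  using assms(1,3)
proof (induction v)
  case (Cons j v)
  have Nil: "[] \<notin> tree_H" using Nil_notin_forest[OF is_forest_tree_of] .
  show ?case
  proof (cases "v = []")
    case True
    have u: "u \<noteq> []" using assms(2) by auto
    let ?k = "last u"
    have su: "suffix [?k] u" using u by (metis append_butlast_last_id suffixI)
    then have k: "region u \<subseteq> region [?k]" "[?k] \<in> vertices (q - 1) tree_H"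
      using region_suffix_mono[OF su _ assms(2)] by auto
    then have "?k < 2" "j < 2" using Cons.prems(1) True Nil by (auto simp: Cons_in_vertices)
    \<comment> \<open>The two roots are joined by the edge at \<open>H\<close>, so their regions are the two sides of one cut.\<close>
    moreover have "dart_elt (u, i) \<in> region [?k]" using k dart_in_region by blast
    then have "cut (vertex_elt [?k]) (dart_elt (u, i)) = cut (vertex_elt [?k]) (vertex_elt [?k])"
      "cut (vertex_elt [j]) (dart_elt (u, i)) = cut (vertex_elt [j]) (vertex_elt [j])"
      using Cons.prems(2) True by (auto simp: region_def)
    ultimately have "?k = j"
      using cut_gx[OF one_closed] cut_self_gx[OF one_closed]
      by (auto simp: less_2_cases_iff)
    then show ?thesis using su True by simp
  next
    case False
    have "v \<in> vertices (q - 1) tree_H" using vertices_tail Cons.prems(1) False by blast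
    then have suf: "suffix v u"
      using Cons region_child_subset[OF Cons.prems(1) False] by blast
    have "u \<noteq> v" using region_child_parent[OF Cons.prems(1) False] Cons.prems(2) by auto
    then obtain k where k: "suffix (k # v) u" using suffix_extend[OF suf] by blast
    then have "region u \<subseteq> region (k # v)" "k # v \<in> vertices (q - 1) tree_H"
      using region_suffix_mono[OF k _ assms(2)] by auto
    then have "k = j"
      using region_siblings[OF _ Cons.prems(1) False _ Cons.prems(2)] dart_in_region by blast
    then show ?thesis using k by simp
  qed
qed simp

lemma region_rcos:
  assumes "g \<in> carrier G" "g' \<in> carrier G" "H #> g = H #> g'" "g \<in> region v"
  shows "g' \<in> region v"
  using assms cut_rcos[OF vertex_elt_closed assms(1-3)] by (simp add: region_def)

text \<open>Unfolding reaches no coset twice. By \<open>coset_walk\<close> it also reaches every coset, so the coset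
graph of \<open>H\<close> is isomorphic to the tree obtained by unfolding it.\<close>

lemma dart_rcos_inj: "inj_on (\<lambda>p. H #> dart_elt p) (darts q tree_H)"
proof (rule inj_onI)
  fix p p' assume p: "p \<in> darts q tree_H" "p' \<in> darts q tree_H" and eq: "H #> dart_elt p = H #> dart_elt p'"
  obtain v i v' i' where vi: "p = (v, i)" "p' = (v', i')" by (cases p, cases p')
  have V: "v \<in> vertices (q - 1) tree_H" "v' \<in> vertices (q - 1) tree_H" using p vi by (auto simp: darts_def)
  have "suffix v' v" "suffix v v'"
    using dart_region_suffix[OF V(2,1), of i] dart_region_suffix[OF V(1,2), of i']
      region_rcos[OF _ _ eq] region_rcos[OF _ _ eq[symmetric]] dart_in_region[of v i] dart_in_region[of v' i']
    unfolding vi by simp_all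
  then have v: "v = v'" by (simp add: suffix_order.antisym)
  show "p = p'"
  proof (cases "v \<in> tree_H")
    case True
    then have "i < q" "i' < q" using p vi v q_pos by (auto simp: darts_def)
    then show ?thesis using branching_slots[OF True] eq vi v by (simp add: dart_elt_def)
  next
    case False
    then show ?thesis using p vi v by (auto simp: darts_def)
  qed
qed

lemma tree_stab_tree_of: "tree_stab tree_H = H"
proof -
  have "g \<in> H \<longleftrightarrow> tree_act tree_H g ([0], 0) = ([0], 0)" if g: "g \<in> carrier G" for g
  proof -
    have "g \<in> H \<longleftrightarrow> H #> g = H #> \<one>"
      using mem_rcos[OF one_closed g] coset_mult_one[OF subgroup.subset[OF sub]] by simp
    also have "\<dots> \<longleftrightarrow> H #> dart_elt (tree_act tree_H g ([0], 0)) = H #> dart_elt ([0], 0)"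
      using conjunct2[OF coset_walk[OF sub g]] by (simp only: dart_elt_root)
    also have "\<dots> \<longleftrightarrow> tree_act tree_H g ([0], 0) = ([0], 0)"
      using inj_on_eq_iff[OF dart_rcos_inj conjunct1[OF coset_walk[OF sub g]] darts_root] .
    finally show ?thesis .
  qed
  then show ?thesis using H_closed unfolding tree_stab_def by blast
qed

lemma finite_tree_of:
  assumes "finite (rcosets H)" shows "finite tree_H"
proof -
  have "(\<lambda>p. H #> dart_elt p) ` darts q tree_H \<subseteq> rcosets H" 
    unfolding RCOSETS_def using dart_elt_closed by blast
  then have "finite (darts q tree_H)"
    using assms dart_rcos_inj by (metis finite_imageD finite_subset)
  then show ?thesis using finite_darts_imp is_forest_tree_of by blast
qed

end

section \<open>Counting the subgroups\<close>

context hecke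
begin

lemma num_subgroups_eq:
  assumes n: "n \<ge> 1"
  shows "num_cyclic_free_product_subgroups q n =
    card {M. finite M \<and> is_forest (q - 1) M \<and> 2 + 2 * (q - 1) * card M = n}"
proof -
  let ?T = "{M. finite M \<and> is_forest (q - 1) M \<and> 2 + 2 * (q - 1) * card M = n}"
  let ?S = "{H. subgroup H G \<and> card (rcosets H) = n \<and> is_free_product_of_cyclic q (G\<lparr>carrier := H\<rparr>)}"
  have T: "tree_of (tree_stab M) = M \<and> tree_stab M \<in> ?S" if "M \<in> ?T" for M
  proof -
    have M: "finite M" "is_forest (q - 1) M" "2 + 2 * (q - 1) * card M = n" using that by blast+
    have "card (rcosets (tree_stab M)) = n"
      using index_tree_stab[OF M(2)] card_darts(2)[OF M(1,2) q_pos] M(3) by (simp only:)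
    then show ?thesis
      using subgroup_tree_stab tree_stab_iso[OF M(2)] tree_of_tree_stab[OF M(2)] by blast
  qed
  have S: "tree_stab (tree_of H) = H \<and> tree_of H \<in> ?T" if "H \<in> ?S" for H
  proof -
    have H: "subgroup H G" "card (rcosets H) = n" "is_free_product_of_cyclic q (G\<lparr>carrier := H\<rparr>)"
      using that by blast+
    interpret cyclic_product_subgroup G q H
      by (intro cyclic_product_subgroup.intro cyclic_product_subgroup_axioms.intro hecke_axioms H)
    have "finite (rcosets H)" using H(2) n by (intro card_ge_0_finite) simp
    then have fin: "finite (tree_of H)" by (rule finite_tree_of)
    have "card (darts q (tree_of H)) = n"
      using index_tree_stab[OF is_forest_tree_of[of H]] H(2) unfolding tree_stab_tree_of by (simp only:)
    then have "2 + 2 * (q - 1) * card (tree_of H) = n"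
      using card_darts(2)[OF fin is_forest_tree_of q_pos] by (simp only:)
    then show ?thesis using fin is_forest_tree_of tree_stab_tree_of by blast
  qed
  have "bij_betw tree_stab ?T ?S"
    by (rule bij_betw_byWitness[where f' = tree_of]) (use T S in blast)+
  then have "card ?T = card ?S" by (rule bij_betw_same_card)
  then show ?thesis
    unfolding num_cyclic_free_product_subgroups_def G_eq[symmetric] by (rule sym)
qed

end

theorem theorem24:
  fixes q n :: nat
  assumes "Factorial_Ring.prime q" and "odd q" and "n \<ge> 1"
  shows "odd (num_cyclic_free_product_subgroups q n) \<longleftrightarrow>
    (\<exists>\<eta>::nat. n = 2 + 4 * (q - 1) * \<eta> \<and>
       bin_digit_sum ((q - 1) * \<eta> + 1) = bin_digit_sum \<eta> + bin_digit_sum ((q - 2) * \<eta> + 1))"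
proof -
  interpret hecke "hecke_group q" q
    using assms group_hecke_group by (intro hecke.intro hecke_axioms.intro) auto
  define k where "k = q - 1"
  have k: "even k" "k > 0" "q - 2 = k - 1" using assms(2) q_ge_3 by (auto simp: k_def)
  let ?T = "{M. finite M \<and> is_forest k M \<and> 2 + 2 * k * card M = n}"
  have N: "num_cyclic_free_product_subgroups q n = card ?T"
    using num_subgroups_eq[OF assms(3)] unfolding k_def .
  show ?thesis
  proof (cases "\<exists>t. n = 2 + 2 * k * t")
    case True
    then obtain t where t: "n = 2 + 2 * k * t" by blast
    have "?T = forests k {[0], [1]} t" unfolding forests_eq t using k(2) by auto
    moreover have "(k * t + 2) * card (forests k {[0], [1]} t) = 2 * ((k * t + 2) choose t)"
    proof -
      have anti: "u = v" if "u \<in> {[0], [1]}" "v \<in> {[0], [1]}" "suffix u v" for u v :: "nat list"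
        using that by (auto simp: suffix_Cons)
      have fin: "finite {[0], [1 :: nat]}" and two: "card {[0], [1 :: nat]} = 2" by simp_all
      have "k \<ge> 1" using k(2) by simp
      from conjunct2[OF card_forests[OF fin anti this, of t]] show ?thesis
        unfolding two .
    qed
    ultimately have "odd (card ?T) \<longleftrightarrow> (\<exists>h. t = 2 * h \<and>
        bin_digit_sum (k * h + 1) = bin_digit_sum h + bin_digit_sum ((k - 1) * h + 1))"
      using odd_forest_number[OF _ k(1,2)] by simp
    moreover have "n = 2 + 4 * k * h \<longleftrightarrow> t = 2 * h" for h
    proof -
      have "n = 2 + 4 * k * h \<longleftrightarrow> 2 * k * t = 2 * k * (2 * h)" unfolding t by simp
      then show ?thesis using k(2) by (simp only: mult_cancel1) simp
    qed
    ultimately show ?thesis unfolding N k(3) k_def[symmetric] by simp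
  next
    case False
    then have empty: "?T = {}" by auto
    have "even (num_cyclic_free_product_subgroups q n)" unfolding N empty by simp
    moreover have "n \<noteq> 2 + 4 * k * h" for h
    proof
      assume "n = 2 + 4 * k * h"
      then have "n = 2 + 2 * k * (2 * h)" by simp
      then show False using False by blast
    qed
    ultimately show ?thesis unfolding k_def[symmetric] by blast
  qed
qed

end
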